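(* Let $J\subseteq\mathbb{R}$ be a nonempty open interval, let $p:J\to\mathbb{R}$ be continuous and positive, and let $\varphi,\psi:J\to\mathbb{R}$ be continuously differentiable functions such that $\psi$ is positive on $J$ and $(\varphi/\psi)'$ is nowhere vanishing on $J$. Define $q:J\to\mathbb{R}$ by $q(u):=u\,p(u)$. Then the equality $$\mathscr{B}_{q,p}(u,v)=\mathscr{B}_{\varphi,\psi}(u,v)\qquad(u,v\in J)$$ is satisfied if and only if at least one of the following holds: (a) $(\varphi,\psi)\sim(q,p)$, i.e., there exist four real constants $a,b,c,d$ with $ad-bc\neq0$ such that, for all $u\in J$, $$\varphi(u)=p(u)(au+b)\qquad\text{and}\qquad\psi(u)=p(u)(cu+d);$$ (b) $\varphi,\psi,p$ are infinitely many times differentiable and there exist three real constants $\alpha,\beta,\gamma$ such that $$W_{\varphi,\psi}=\gamma p^2,\qquad W_{q',p'}=\alpha\,(W_{q,p})^3\qquad\text{and}\qquad W_{\varphi',\psi'}=\beta\,(W_{\varphi,\psi})^3$$ hold on $J$.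
   Context: For functions $f,g:J\to\mathbb{R}$ with $g$ continuous and positive and $f/g$ continuous and strictly monotone, the two-variable Bajraktarević mean $\mathscr{B}_{f,g}:J^2\to J$ is $$\mathscr{B}_{f,g}(u,v):=\Big(\frac fg\Big)^{-1}\Big(\frac{f(u)+f(v)}{g(u)+g(v)}\Big)\qquad(u,v\in J).$$ In particular $\mathscr{B}_{q,p}(u,v)=\dfrac{p(u)u+p(v)v}{p(u)+p(v)}$. For differentiable $f,g:J\to\mathbb{R}$, the Wronskian is $W_{f,g}:=f'g-fg'$; accordingly $W_{f',g'}=f''g'-f'g''$. For pairs of functions, $(f,g)\sim(h,k)$ means that there exist real constants $a,b,c,d$ with $ad-bc\neq0$ such that $h=af+bg$ and $k=cf+dg$ hold on $J$ (this is a symmetric relation). *)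

theory Defs
  imports "HOL-Analysis.Analysis"
begin

(* The domain J cannot be read off from a function real => real, so it is passed explicitly:
   it selects the branch on which f/g is inverted. The definition is meaningful when g is
   positive on J and f/g is continuous and strictly monotone on the interval J. *)
definition bajraktarevic_mean ::
    "real set \<Rightarrow> (real \<Rightarrow> real) \<Rightarrow> (real \<Rightarrow> real) \<Rightarrow> real \<Rightarrow> real \<Rightarrow> real" where
  "bajraktarevic_mean J f g u v =
     inv_into J (\<lambda>x. f x / g x) ((f u + f v) / (g u + g v))"

definition wronskian :: "(real \<Rightarrow> real) \<Rightarrow> (real \<Rightarrow> real) \<Rightarrow> real \<Rightarrow> real" where
  "wronskian f g u = deriv f u * g u - f u * deriv g u"

definition pair_equiv ::
    "real set \<Rightarrow> (real \<Rightarrow> real) \<times> (real \<Rightarrow> real) \<Rightarrow> (real \<Rightarrow> real) \<times> (real \<Rightarrow> real) \<Rightarrow> bool" where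
  "pair_equiv J = (\<lambda>(f, g) (h, k). \<exists>a b c d. a * d - b * c \<noteq> 0 \<and>
     (\<forall>u\<in>J. h u = a * f u + b * g u \<and> k u = c * f u + d * g u))"

(* Intended for open J, where the iterates of deriv on J depend only on the values of f on J. *)
definition infinitely_differentiable_on :: "(real \<Rightarrow> real) \<Rightarrow> real set \<Rightarrow> bool" where
  "infinitely_differentiable_on f J \<longleftrightarrow>
     (\<forall>n. \<forall>u\<in>J. (deriv ^^ n) f field_differentiable (at u))"

lemma pair_equiv_sym:
  assumes "pair_equiv J (f, g) (h, k)"
  shows "pair_equiv J (h, k) (f, g)"
proof -
  obtain a b c d where D: "a * d - b * c \<noteq> 0"
    and E: "\<And>u. u \<in> J \<Longrightarrow> h u = a * f u + b * g u \<and> k u = c * f u + d * g u"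
    using assms by (auto simp: pair_equiv_def)
  define D' where "D' = a * d - b * c"
  have nz: "D' \<noteq> 0" using D by (simp add: D'_def)
  have eqs: "f u = (d / D') * h u + (- b / D') * k u \<and> g u = (- c / D') * h u + (a / D') * k u"
    if "u \<in> J" for u
  proof -
    have "D' * f u = d * h u - b * k u" "D' * g u = a * k u - c * h u"
      using E[OF that] by (simp_all add: D'_def algebra_simps)
    then show ?thesis using nz by (simp add: field_simps)
  qed
  have "(d / D') * (a / D') - (- b / D') * (- c / D') = D' / (D' * D')"
    by (simp add: D'_def diff_divide_distrib mult.commute)
  then have "(d / D') * (a / D') - (- b / D') * (- c / D') \<noteq> 0" using nz by simp
  then show ?thesis unfolding pair_equiv_def using eqs by blast
qed

lemma pair_equiv_times_ident_iff:
  assumes "\<And>u. u \<in> J \<Longrightarrow> q u = u * p u"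
  shows "pair_equiv J (\<phi>, \<psi>) (q, p) \<longleftrightarrow>
    (\<exists>a b c d. a * d - b * c \<noteq> 0 \<and>
       (\<forall>u\<in>J. \<phi> u = p u * (a * u + b) \<and> \<psi> u = p u * (c * u + d)))"
proof -
  have "pair_equiv J (\<phi>, \<psi>) (q, p) \<longleftrightarrow> pair_equiv J (q, p) (\<phi>, \<psi>)"
    using pair_equiv_sym by blast
  also have "\<dots> \<longleftrightarrow> (\<exists>a b c d. a * d - b * c \<noteq> 0 \<and>
       (\<forall>u\<in>J. \<phi> u = p u * (a * u + b) \<and> \<psi> u = p u * (c * u + d)))"
    by (simp add: pair_equiv_def assms algebra_simps cong: ball_cong)
  finally show ?thesis .
qed

end

theory Submission
  imports Defs
begin

text \<open>
  Write \<open>m(u, v) = (u p(u) + v p(v)) / (p(u) + p(v))\<close>, \<open>W = \<phi>' \<psi> - \<phi> \<psi>'\<close> and \<open>F = \<phi> / \<psi>\<close>. Since \<open>F\<close> is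
  injective and maps the interval onto an interval, the equality of the two means is the functional
  equation \<open>\<phi>(m) (\<psi>(u) + \<psi>(v)) = \<psi>(m) (\<phi>(u) + \<phi>(v))\<close> (\<open>means_eq_iff\<close>). In the plane it says that the
  curves \<open>(q, p)\<close> and \<open>(\<phi>, \<psi>)\<close> assign the same parameter \<open>m\<close> to the direction of the sum of their
  points at \<open>u\<close> and \<open>v\<close>.

  \<^emph>\<open>From equality to smoothness.\<close> The equation expresses \<open>F(m)\<close>, hence \<open>m\<close>, hence the weight \<open>p\<close> through
  \<open>C\<^sup>1\<close> functions, so \<open>p\<close> is \<open>C\<^sup>1\<close> and the equation may be differentiated in \<open>u\<close>. The result, read for
  fixed \<open>u\<close> as a formula for \<open>W(m(u, v))\<close>, shows that \<open>W\<close> is differentiable with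
  \<open>W' / W = 2 p' / p\<close>; hence \<open>W = \<gamma> p\<^sup>2\<close> (\<open>wronskian_proportional\<close>). Read for fixed \<open>v\<close>, it has become a
  linear relation between \<open>p'(u)\<close> and \<open>\<psi>'(u)\<close> whose coefficients are as smooth as \<open>p\<close>, \<open>\<phi>\<close>, \<open>\<psi>\<close>
  themselves. If at each point two values of \<open>v\<close> give independent relations, the derivatives are as
  smooth as the functions, and all three functions are \<open>C\<^sup>\<infinity>\<close> (\<open>bootstrap\<close>). If the relations are
  dependent at one single point, then \<open>F\<close> is a Moebius transformation near it; with \<open>W = \<gamma> p\<^sup>2\<close> this
  makes \<open>\<phi> / p\<close> and \<open>\<psi> / p\<close> affine near that point, and the functional equation carries this over to the
  whole interval (\<open>degenerate_agreement\<close>, \<open>agreement_global\<close>), which is alternative (a).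

  \<^emph>\<open>Smooth solutions.\<close> In the parameter \<open>s\<close> with \<open>s' = p\<^sup>2\<close> the functions \<open>q, p\<close> solve
  \<open>y\<^sub>s\<^sub>s = - \<kappa> y\<close> and \<open>\<phi>, \<psi>\<close> solve \<open>y\<^sub>s\<^sub>s = - \<mu> y\<close>, where \<open>\<kappa>\<close> and \<open>\<mu>\<close> are the second Wronskians divided by
  \<open>p\<^sup>6\<close> and \<open>\<gamma> p\<^sup>6\<close>; for smooth functions alternative (b) says that
  \<open>W = \<gamma> p\<^sup>2\<close> and that \<open>\<kappa>\<close> and \<open>\<mu>\<close> are constant. Fix a point \<open>x\<^sub>0\<close> and let \<open>X(u) = p(u) (u - x\<^sub>0)\<close> and \<open>Z(u) = \<phi>(u) \<psi>(x\<^sub>0) - \<psi>(u) \<phi>(x\<^sub>0)\<close> be the solutions that vanish at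
  \<open>x\<^sub>0\<close>. Then \<open>m(u, v) = x\<^sub>0\<close> means \<open>X(u) + X(v) = 0\<close>, and the functional equation means
  \<open>Z(u) + Z(v) = 0\<close>; so it says that \<open>Z\<close> is an \<^emph>\<open>odd function of\<close> \<open>X\<close>. Comparing the two sides of this
  oddness at \<open>x\<^sub>0\<close> gives \<open>\<mu>' = \<kappa>'\<close>, and gives \<open>\<kappa>' = 0\<close> if the constant \<open>\<mu> - \<kappa>\<close> is not zero
  (\<open>comparison_at\<close>). If \<open>\<mu> = \<kappa>\<close>, both pairs solve the same linear equation and (a) holds; otherwise both
  coefficients are constant and (b) holds (\<open>smooth_dichotomy\<close>).

  \<^emph>\<open>Converse.\<close> Under (a) the functional equation is an algebraic identity. Under (b) each of \<open>X\<close> and \<open>Z\<close> is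
  an odd function (a multiple of a sine, a hyperbolic sine or the identity) of \<open>s - s(x\<^sub>0)\<close>. So if
  \<open>x\<^sub>0\<close> is the point with \<open>2 s(x\<^sub>0) = s(u) + s(v)\<close>, both sums vanish and both means are equal to \<open>x\<^sub>0\<close>:
  they are the quasi-arithmetic mean generated by \<open>s\<close> (\<open>equation_of_constant_coefficients\<close>).
\<close>

section \<open>Parity, local inverses and differentiability\<close>

lemma derivative_parity:
  fixes f f' :: "real \<Rightarrow> real"
  assumes der: "\<And>x. \<bar>x\<bar> < r \<Longrightarrow> (f has_real_derivative f' x) (at x)"
    and par: "\<And>x. \<bar>x\<bar> < r \<Longrightarrow> f (- x) = c * f x"
    and x: "\<bar>x\<bar> < r"
  shows "f' (- x) = - c * f' x"
proof -
  have 1: "((\<lambda>y. f (- y)) has_real_derivative - f' (- x)) (at x)"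
    using der[of "- x"] x DERIV_mirror[of f "f' (- x)" x] by simp
  have 2: "((\<lambda>y. c * f y) has_real_derivative c * f' x) (at x)"
    using der[OF x] by (auto intro!: derivative_eq_intros)
  have "((\<lambda>y. f (- y)) has_real_derivative c * f' x) (at x)"
  proof (rule has_field_derivative_transform_within_open[OF 2])
    show "open {-r<..<r}" "x \<in> {-r<..<r}" using x by auto
    show "\<And>y. y \<in> {-r<..<r} \<Longrightarrow> c * f y = f (- y)" using par by auto
  qed
  with 1 have "- f' (- x) = c * f' x" by (rule DERIV_unique)
  then show ?thesis by simp
qed

lemma symmetric_difference_quotient:
  fixes f :: "real \<Rightarrow> real"
  assumes "(f has_real_derivative D) (at 0)"
  shows "((\<lambda>x. (f x - f (- x)) / x) \<longlongrightarrow> 2 * D) (at 0)"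
proof -
  have "((\<lambda>y. f (- y)) has_real_derivative - D) (at 0)"
    using assms DERIV_mirror[of f D 0] by simp
  then have "((\<lambda>x. f x - f (- x)) has_real_derivative D - (- D)) (at 0)"
    by (intro DERIV_diff assms)
  then show ?thesis by (simp add: DERIV_def)
qed

text \<open>The one-dimensional inverse function theorem with the derivative of the inverse on a whole interval
  of values, where \<open>f'\<close> also keeps its sign.\<close>

lemma real_local_inverse:
  fixes f f' :: "real \<Rightarrow> real"
  assumes S: "open S" "x \<in> S"
    and der: "\<And>y. y \<in> S \<Longrightarrow> (f has_real_derivative f' y) (at y)"
    and cont: "isCont f' x" and nz: "f' x \<noteq> 0"
  obtains r g where "0 < r" "g (f x) = x"
    "\<And>y. \<bar>y - f x\<bar> < r \<Longrightarrow> g y \<in> S \<and> f (g y) = y \<and> 0 < f' x * f' (g y) \<and>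
            (g has_real_derivative inverse (f' (g y))) (at y)"
proof -
  have "isCont (\<lambda>y. f' x * f' y) x" by (intro continuous_intros cont)
  moreover have "0 < f' x * f' x" using nz by (simp add: zero_less_mult_iff) linarith
  ultimately have "\<forall>\<^sub>F y in nhds x. 0 < f' x * f' y"
    by (metis order_tendstoD(1) isCont_def tendsto_at_iff_tendsto_nhds)
  moreover have "\<forall>\<^sub>F y in nhds x. y \<in> S" using S eventually_nhds by blast
  ultimately have "\<forall>\<^sub>F y in nhds x. y \<in> S \<and> 0 < f' x * f' y" by eventually_elim simp
  then obtain d where d: "0 < d" "\<And>y. dist y x < d \<Longrightarrow> y \<in> S \<and> 0 < f' x * f' y"
    by (auto simp: eventually_nhds_metric)
  define D where "D = {x - d<..<x + d}"
  have D: "open D" "x \<in> D" "\<And>y. y \<in> D \<Longrightarrow> y \<in> S \<and> 0 < f' x * f' y"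
    using d by (auto simp: D_def dist_real_def)
  have inj: "inj_on f D"
  proof (rule linorder_inj_onI)
    fix a b assume ab: "a < b" "a \<in> D" "b \<in> D"
    then have sub: "c \<in> D" if "a \<le> c" "c \<le> b" for c using that by (auto simp: D_def)
    obtain z where z: "a < z" "z < b" "f b - f a = (b - a) * f' z"
      using MVT2[of a b f f'] ab sub D der by blast
    then have "f' z \<noteq> 0" using D(3)[OF sub[of z]] by auto
    then show "f a \<noteq> f b" using z ab by auto
  qed auto
  have cf: "continuous_on D f"
    using D der by (meson DERIV_isCont continuous_at_imp_continuous_on)
  define g where "g = inv_into D f"
  have gf: "g (f z) = z" if "z \<in> D" for z using inj that by (simp add: g_def)
  have "open (f ` D)"
    by (rule invariance_of_domain[OF cf D(1) inj])
  moreover have "f x \<in> f ` D" using D by blast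
  ultimately obtain r where r: "0 < r" "ball (f x) r \<subseteq> f ` D" by (meson open_contains_ball)
  show ?thesis
  proof (rule that[where r = r and g = g])
    show "0 < r" "g (f x) = x" using r(1) gf[OF D(2)] by auto
  next
    fix y assume "\<bar>y - f x\<bar> < r"
    then have "y \<in> f ` D" using r(2) by (auto simp: dist_real_def abs_minus_commute subset_iff)
    then obtain z where z: "z \<in> D" "y = f z" by blast
    have nzz: "f' z \<noteq> 0" using D(3)[OF z(1)] by auto
    have "(g has_derivative (*) (inverse (f' z))) (at (f z))"
      using D(1) z(1) cf gf
    proof (rule has_derivative_inverse_strong)
      show "(f has_derivative (*) (f' z)) (at z)"
        using der D(3)[OF z(1)] by (simp add: has_field_derivative_def)
      show "(*) (f' z) \<circ> (*) (inverse (f' z)) = id" using nzz by (auto simp: fun_eq_iff)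
    qed
    then show "g y \<in> S \<and> f (g y) = y \<and> 0 < f' x * f' (g y) \<and>
            (g has_real_derivative inverse (f' (g y))) (at y)"
      using z D(3)[OF z(1)] gf[OF z(1)] by (simp add: has_field_derivative_def)
  qed
qed

lemma isCont_tendsto_nhds: "isCont f x \<Longrightarrow> (f \<longlongrightarrow> f x) (nhds x)"
  by (simp add: isCont_def tendsto_at_iff_tendsto_nhds)

text \<open>A continuous function inherits differentiability from its composite with a function that has a
  nonzero derivative: with Caratheodory's factor \<open>h\<close> of \<open>f\<close>, the difference quotient of \<open>g\<close> is that of the
  composite divided by \<open>h \<circ> g\<close>.\<close>

lemma DERIV_cancel_outer:
  fixes f g :: "real \<Rightarrow> real"
  assumes f: "(f has_real_derivative D) (at (g x))" "D \<noteq> 0" and g: "isCont g x"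
    and fg: "((\<lambda>y. f (g y)) has_real_derivative E) (at x)"
  shows "(g has_real_derivative E / D) (at x)"
proof -
  obtain h where h: "\<And>z. f z - f (g x) = h z * (z - g x)" "isCont h (g x)" "h (g x) = D"
    using f(1) unfolding CARAT_DERIV by blast
  have "isCont (\<lambda>y. h (g y)) x" using g h(2) by (rule isCont_o2)
  then have lim: "((\<lambda>y. h (g y)) \<longlongrightarrow> D) (at x)" using h(3) by (simp add: isCont_def)
  have "((\<lambda>y. (f (g y) - f (g x)) / (y - x) / h (g y)) \<longlongrightarrow> E / D) (at x)"
    using fg lim f(2) by (intro tendsto_divide) (auto simp: has_field_derivative_iff)
  moreover have "\<forall>\<^sub>F y in at x. (f (g y) - f (g x)) / (y - x) / h (g y) = (g y - g x) / (y - x)"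
    using tendsto_imp_eventually_ne[OF lim f(2)]
    by eventually_elim (simp add: h(1))
  ultimately show ?thesis
    unfolding has_field_derivative_iff by (rule Lim_transform_eventually)
qed

section \<open>Functions that are n times differentiable\<close>

text \<open>Differentiability of order \<open>n\<close> in recursive form, so that the calculus rules follow by induction. The
  order \<open>0\<close> imposes nothing, not even continuity; this makes it a legitimate start for the bootstrap
  argument below.\<close>

primrec ndiff :: "nat \<Rightarrow> (real \<Rightarrow> real) \<Rightarrow> real set \<Rightarrow> bool" where
  "ndiff 0 f S \<longleftrightarrow> True"
| "ndiff (Suc n) f S \<longleftrightarrow> (\<forall>x\<in>S. f field_differentiable at x) \<and> ndiff n (deriv f) S"

lemma ndiff_iff: "ndiff n f S \<longleftrightarrow> (\<forall>k<n. \<forall>x\<in>S. (deriv ^^ k) f field_differentiable at x)"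
  by (induction n arbitrary: f) (auto simp: All_less_Suc2 funpow_swap1)

lemma infinitely_differentiable_on_iff_ndiff:
  "infinitely_differentiable_on f S \<longleftrightarrow> (\<forall>n. ndiff n f S)"
  by (auto simp: infinitely_differentiable_on_def ndiff_iff)

lemma ndiff_SucD: "ndiff (Suc n) f S \<Longrightarrow> ndiff n f S"
  by (auto simp: ndiff_iff)

lemma ndiff_subset: "ndiff n f S \<Longrightarrow> T \<subseteq> S \<Longrightarrow> ndiff n f T"
  by (auto simp: ndiff_iff)

lemma ndiff_local:
  assumes "\<And>x. x \<in> S \<Longrightarrow> \<exists>U. x \<in> U \<and> ndiff n f U"
  shows "ndiff n f S"
  using assms unfolding ndiff_iff by blast

lemma ndiff_cong:
  assumes "open S" "\<And>x. x \<in> S \<Longrightarrow> f x = g x" "ndiff n f S"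
  shows "ndiff n g S"
  using assms(2,3)
proof (induction n arbitrary: f g)
  case (Suc n)
  have "(g has_real_derivative deriv f x) (at x)" if "x \<in> S" for x
  proof (rule has_field_derivative_transform_within_open[OF _ assms(1) that Suc.prems(1)])
    show "(f has_real_derivative deriv f x) (at x)"
      using Suc.prems(2) that by (simp add: DERIV_deriv_iff_field_differentiable)
  qed
  then have "\<forall>x\<in>S. g field_differentiable at x \<and> deriv f x = deriv g x"
    by (metis DERIV_imp_deriv field_differentiable_def)
  moreover have "ndiff n (deriv g) S"
    by (rule Suc.IH[of "deriv f"]) (use Suc.prems calculation in auto)
  ultimately show ?case by auto
qed simp

lemma ndiff_SucI:
  assumes "open S" "\<And>x. x \<in> S \<Longrightarrow> (f has_real_derivative f' x) (at x)" "ndiff n f' S"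
  shows "ndiff (Suc n) f S"
proof -
  have "ndiff n (deriv f) S"
    by (rule ndiff_cong[OF assms(1) _ assms(3)]) (metis assms(2) DERIV_imp_deriv)
  then show ?thesis using assms(2) by (auto simp: field_differentiable_def)
qed

lemma ndiff_SucE:
  assumes "ndiff (Suc n) f S" "x \<in> S"
  shows "(f has_real_derivative deriv f x) (at x)"
  using assms by (auto simp: DERIV_deriv_iff_field_differentiable)

lemma ndiff_const: "ndiff n (\<lambda>x. c) S"
  by (induction n arbitrary: c) auto

lemma ndiff_ident: "open S \<Longrightarrow> ndiff n (\<lambda>x. x) S"
  by (cases n) (simp, metis ndiff_SucI ndiff_const DERIV_ident)

lemma ndiff_add:
  assumes "open S" "ndiff n f S" "ndiff n g S"
  shows "ndiff n (\<lambda>x. f x + g x) S"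
  using assms(2,3)
proof (induction n arbitrary: f g)
  case (Suc n)
  show ?case
    by (rule ndiff_SucI[OF assms(1), of _ "\<lambda>x. deriv f x + deriv g x"])
       (use Suc in \<open>auto intro!: DERIV_add ndiff_SucE[of n]\<close>)
qed simp

lemma ndiff_mult:
  assumes "open S" "ndiff n f S" "ndiff n g S"
  shows "ndiff n (\<lambda>x. f x * g x) S"
  using assms(2,3)
proof (induction n arbitrary: f g)
  case (Suc n)
  show ?case
  proof (rule ndiff_SucI[OF assms(1), of _ "\<lambda>x. deriv f x * g x + deriv g x * f x"])
    show "ndiff n (\<lambda>x. deriv f x * g x + deriv g x * f x) S"
      using Suc.prems Suc.prems[THEN ndiff_SucD] by (intro ndiff_add assms(1) Suc.IH) auto
  qed (use Suc.prems in \<open>auto intro!: DERIV_mult ndiff_SucE[of n]\<close>)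
qed simp

lemma ndiff_minus: "open S \<Longrightarrow> ndiff n f S \<Longrightarrow> ndiff n (\<lambda>x. - f x) S"
  using ndiff_mult[of S n "\<lambda>_. - 1" f] ndiff_const by simp

lemma ndiff_diff:
  "open S \<Longrightarrow> ndiff n f S \<Longrightarrow> ndiff n g S \<Longrightarrow> ndiff n (\<lambda>x. f x - g x) S"
  using ndiff_add[of S n f "\<lambda>x. - g x"] ndiff_minus by simp

lemma ndiff_power: "open S \<Longrightarrow> ndiff n f S \<Longrightarrow> ndiff n (\<lambda>x. f x ^ k) S"
  by (induction k) (auto intro: ndiff_const ndiff_mult)

lemma ndiff_inverse:
  assumes "open S" "ndiff n f S" "\<And>x. x \<in> S \<Longrightarrow> f x \<noteq> 0"
  shows "ndiff n (\<lambda>x. inverse (f x)) S"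
  using assms(2)
proof (induction n)
  case (Suc n)
  show ?case
  proof (rule ndiff_SucI[OF assms(1), of _ "\<lambda>x. - (inverse (f x) * deriv f x * inverse (f x))"])
    show "ndiff n (\<lambda>x. - (inverse (f x) * deriv f x * inverse (f x))) S"
      using Suc.prems Suc.IH[OF Suc.prems[THEN ndiff_SucD]]
      by (intro ndiff_minus ndiff_mult assms(1)) auto
  qed (use Suc.prems assms(3) in \<open>auto intro!: DERIV_inverse' ndiff_SucE[of n]\<close>)
qed simp

lemma ndiff_divide:
  assumes "open S" "ndiff n f S" "ndiff n g S" "\<And>x. x \<in> S \<Longrightarrow> g x \<noteq> 0"
  shows "ndiff n (\<lambda>x. f x / g x) S"
  unfolding divide_inverse by (intro ndiff_mult ndiff_inverse assms)

lemma ndiff_compose: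
  assumes "open S" "ndiff n f T" "ndiff n g S" "\<And>x. x \<in> S \<Longrightarrow> g x \<in> T"
  shows "ndiff n (\<lambda>x. f (g x)) S"
  using assms(2,3)
proof (induction n arbitrary: f)
  case (Suc n)
  show ?case
  proof (rule ndiff_SucI[OF assms(1), of _ "\<lambda>x. deriv f (g x) * deriv g x"])
    show "ndiff n (\<lambda>x. deriv f (g x) * deriv g x) S"
      using Suc.prems(1,2) Suc.IH[of "deriv f"] Suc.prems(2)[THEN ndiff_SucD]
      by (intro ndiff_mult assms(1)) auto
    show "((\<lambda>x. f (g x)) has_real_derivative deriv f (g x) * deriv g x) (at x)" if "x \<in> S" for x
      by (rule DERIV_chain2[OF ndiff_SucE[OF Suc.prems(1) assms(4)] ndiff_SucE[OF Suc.prems(2)]])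
         (fact that)+
  qed
qed simp

section \<open>Linear equations of second order\<close>

text \<open>The equation is \<open>y\<^sub>s\<^sub>s = - c y\<close> in the parameter \<open>s\<close>, with \<open>w = s'\<close> and \<open>y1 = y\<^sub>s\<close>. The energy
  \<open>y\<^sup>2 + y1\<^sup>2\<close> grows at most exponentially in \<open>s\<close> in both directions, so it stays zero once it is zero.\<close>

lemma linear_ode_unique:
  fixes y y1 s w :: "real \<Rightarrow> real"
  assumes dy: "\<And>t. t \<in> {a..b} \<Longrightarrow> (y has_real_derivative w t * y1 t) (at t)"
    and dy1: "\<And>t. t \<in> {a..b} \<Longrightarrow> (y1 has_real_derivative - c * w t * y t) (at t)"
    and ds: "\<And>t. t \<in> {a..b} \<Longrightarrow> (s has_real_derivative w t) (at t)"
    and w: "\<And>t. t \<in> {a..b} \<Longrightarrow> 0 \<le> w t"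
    and t0: "t0 \<in> {a..b}" "y t0 = 0" "y1 t0 = 0" and t: "t \<in> {a..b}"
  shows "y t = 0"
proof -
  define C where "C = 1 + \<bar>c\<bar>"
  define E where "E = (\<lambda>t. (y t)\<^sup>2 + (y1 t)\<^sup>2)"
  have dE: "(E has_real_derivative 2 * w x * (1 - c) * (y x * y1 x)) (at x)" if "x \<in> {a..b}" for x
    unfolding E_def by (auto intro!: derivative_eq_intros dy dy1 that simp: algebra_simps)
  have bound: "\<bar>2 * w x * (1 - c) * (y x * y1 x)\<bar> \<le> C * w x * E x" if x: "x \<in> {a..b}" for x
  proof -
    have "2 * \<bar>y x * y1 x\<bar> \<le> E x"
      using sum_squares_bound[of "\<bar>y x\<bar>" "\<bar>y1 x\<bar>"] by (simp add: E_def abs_mult)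
    moreover have "\<bar>1 - c\<bar> \<le> C" by (simp add: C_def)
    ultimately have "\<bar>1 - c\<bar> * (2 * \<bar>y x * y1 x\<bar>) \<le> C * E x"
      by (intro mult_mono) (auto simp: C_def)
    then have "w x * (\<bar>1 - c\<bar> * (2 * \<bar>y x * y1 x\<bar>)) \<le> w x * (C * E x)"
      using w[OF x] by (rule mult_left_mono)
    moreover have "\<bar>2 * w x * (1 - c) * (y x * y1 x)\<bar> = w x * (\<bar>1 - c\<bar> * (2 * \<bar>y x * y1 x\<bar>))"
      using w[OF x] by (simp only: abs_mult abs_numeral abs_of_nonneg mult_ac)
    ultimately show ?thesis by (simp add: mult_ac)
  qed
  have dG: "((\<lambda>x. E x * exp (k * s x)) has_real_derivative
      (2 * w x * (1 - c) * (y x * y1 x) + k * w x * E x) * exp (k * s x)) (at x)"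
    if "x \<in> {a..b}" for x k
    by (auto intro!: derivative_eq_intros dE ds that simp: algebra_simps)
  have E0: "E t0 = 0" using t0 by (simp add: E_def)
  have "E t \<le> 0"
  proof (cases "t0 \<le> t")
    case True
    have "E t * exp (- C * s t) \<le> E t0 * exp (- C * s t0)"
    proof (rule DERIV_nonpos_imp_nonincreasing[OF True], intro exI conjI)
      fix x assume "t0 \<le> x" "x \<le> t"
      then have x: "x \<in> {a..b}" using t0 t by auto
      show "((\<lambda>x. E x * exp (- C * s x)) has_real_derivative
        (2 * w x * (1 - c) * (y x * y1 x) + - C * w x * E x) * exp (- C * s x)) (at x)"
        by (rule dG[OF x])
      show "(2 * w x * (1 - c) * (y x * y1 x) + - C * w x * E x) * exp (- C * s x) \<le> 0"
        using bound[OF x] by (intro mult_nonpos_nonneg) auto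
    qed
    then show ?thesis by (simp add: E0 mult_le_0_iff)
  next
    case False
    then have le: "t \<le> t0" by simp
    have "E t * exp (C * s t) \<le> E t0 * exp (C * s t0)"
    proof (rule DERIV_nonneg_imp_nondecreasing[OF le], intro exI conjI)
      fix x assume "t \<le> x" "x \<le> t0"
      then have x: "x \<in> {a..b}" using t0 t by auto
      show "((\<lambda>x. E x * exp (C * s x)) has_real_derivative
        (2 * w x * (1 - c) * (y x * y1 x) + C * w x * E x) * exp (C * s x)) (at x)"
        by (rule dG[OF x])
      show "0 \<le> (2 * w x * (1 - c) * (y x * y1 x) + C * w x * E x) * exp (C * s x)"
        using bound[OF x] by (intro mult_nonneg_nonneg) auto
    qed
    then show ?thesis by (simp add: E0 mult_le_0_iff)
  qed
  then have "(y t)\<^sup>2 \<le> 0" unfolding E_def using zero_le_power2[of "y1 t"] by linarith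
  then show ?thesis by simp
qed

lemma odd_fundamental_solution:
  fixes c :: real
  obtains S S1 :: "real \<Rightarrow> real" where
    "\<And>t. (S has_real_derivative S1 t) (at t)" "\<And>t. (S1 has_real_derivative - c * S t) (at t)"
    "S 0 = 0" "S1 0 = 1" "\<And>t. S (- t) = - S t"
proof (cases c "0 :: real" rule: linorder_cases)
  case less
  define k where "k = sqrt (- c)"
  have k: "k \<noteq> 0" "k * k = - c" using less by (auto simp: k_def)
  show ?thesis
  proof (rule that[of "\<lambda>t. sinh (k * t) / k" "\<lambda>t. cosh (k * t)"])
    show "((\<lambda>t. sinh (k * t) / k) has_real_derivative cosh (k * t)) (at t)" for t
      using k(1) by (auto intro!: derivative_eq_intros)
    show "((\<lambda>t. cosh (k * t)) has_real_derivative - c * (sinh (k * t) / k)) (at t)" for t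
      unfolding k(2)[symmetric] using k(1) by (auto intro!: derivative_eq_intros)
  qed auto
next
  case equal
  show ?thesis
    by (rule that[of "\<lambda>t. t" "\<lambda>t. 1"]) (use equal in \<open>auto intro!: derivative_eq_intros\<close>)
next
  case greater
  define k where "k = sqrt c"
  have k: "k \<noteq> 0" "k * k = c" using greater by (auto simp: k_def)
  show ?thesis
  proof (rule that[of "\<lambda>t. sin (k * t) / k" "\<lambda>t. cos (k * t)"])
    show "((\<lambda>t. sin (k * t) / k) has_real_derivative cos (k * t)) (at t)" for t
      using k(1) by (auto intro!: derivative_eq_intros)
    show "((\<lambda>t. cos (k * t)) has_real_derivative - c * (sin (k * t) / k)) (at t)" for t
      unfolding k(2)[symmetric] using k(1) by (auto intro!: derivative_eq_intros)
  qed auto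
qed

text \<open>A solution that vanishes at \<open>t0\<close> is a multiple of the odd fundamental solution in \<open>s - s(t0)\<close>, so it takes
  opposite values at two points whose parameters are symmetric about \<open>s(t0)\<close>.\<close>

lemma solution_odd_about:
  fixes y y1 s w :: "real \<Rightarrow> real"
  assumes dy: "\<And>t. t \<in> {a..b} \<Longrightarrow> (y has_real_derivative w t * y1 t) (at t)"
    and dy1: "\<And>t. t \<in> {a..b} \<Longrightarrow> (y1 has_real_derivative - c * w t * y t) (at t)"
    and ds: "\<And>t. t \<in> {a..b} \<Longrightarrow> (s has_real_derivative w t) (at t)"
    and w: "\<And>t. t \<in> {a..b} \<Longrightarrow> 0 \<le> w t"
    and t0: "t0 \<in> {a..b}" "y t0 = 0" and ab: "a \<le> b" and mid: "s a + s b = 2 * s t0"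
  shows "y a + y b = 0"
proof -
  obtain S S1 where S: "\<And>t. (S has_real_derivative S1 t) (at t)" "\<And>t. (S1 has_real_derivative - c * S t) (at t)"
    "S 0 = 0" "S1 0 = 1" "\<And>t. S (- t) = - S t" using odd_fundamental_solution by blast
  define k where "k = y1 t0"
  have dS: "((\<lambda>t. S (s t - s t0)) has_real_derivative S1 (s t - s t0) * w t) (at t)"
    "((\<lambda>t. S1 (s t - s t0)) has_real_derivative - c * S (s t - s t0) * w t) (at t)" if "t \<in> {a..b}" for t
    using DERIV_chain2[OF S(1), of "\<lambda>t. s t - s t0" "w t"] DERIV_chain2[OF S(2), of "\<lambda>t. s t - s t0" "w t"]
      DERIV_diff[OF ds[OF that] DERIV_const[of "s t0"]] by auto
  have sol: "y t = k * S (s t - s t0)" if t: "t \<in> {a..b}" for t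
  proof -
    have "(\<lambda>t. y t - k * S (s t - s t0)) t = 0"
    proof (rule linear_ode_unique[where ?y1.0 = "\<lambda>t. y1 t - k * S1 (s t - s t0)", OF _ _ ds w t0(1) _ _ t])
      fix x assume x: "x \<in> {a..b}"
      show "((\<lambda>t. y t - k * S (s t - s t0)) has_real_derivative w x * (y1 x - k * S1 (s x - s t0))) (at x)"
        using DERIV_diff[OF dy[OF x] DERIV_cmult[OF dS(1)[OF x], of k]] by (simp add: algebra_simps)
      show "((\<lambda>t. y1 t - k * S1 (s t - s t0)) has_real_derivative - c * w x * (y x - k * S (s x - s t0))) (at x)"
        using DERIV_diff[OF dy1[OF x] DERIV_cmult[OF dS(2)[OF x], of k]] by (simp add: algebra_simps)
    qed (use S t0 k_def in auto)
    then show ?thesis by simp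
  qed
  have "s b - s t0 = - (s a - s t0)" using mid by simp
  then show ?thesis using sol[of a] sol[of b] ab S(5)[of "s a - s t0"] by simp
qed

section \<open>Two solutions that are odd functions of each other\<close>

text \<open>Let \<open>X\<close> and \<open>Z\<close> solve \<open>X\<^sub>s\<^sub>s = - \<kappa> X\<close> and \<open>Z\<^sub>s\<^sub>s = - \<mu> Z\<close> near a common zero, with \<open>X\<^sub>s > 0\<close>. Here \<open>x = X\<close>
  is taken as the variable: \<open>\<Theta>\<close>, \<open>\<eta>\<close> and \<open>\<zeta>\<close> are \<open>Z\<close>, \<open>X\<^sub>s\<close> and \<open>Z\<^sub>s\<close> as functions of \<open>x\<close>. The equations
  become \<open>\<Theta>' = \<zeta> / \<eta>\<close>, \<open>\<eta> \<eta>' = - \<kappa> x\<close> and \<open>\<eta> \<zeta>' = - \<mu> \<Theta>\<close>. The hypothesis is that \<open>Z\<close> is an odd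
  function of \<open>X\<close>; the question is what this forces on the derivatives \<open>k\<close> and \<open>l\<close> of \<open>\<kappa>\<close> and \<open>\<mu>\<close> at
  the zero.\<close>

locale odd_comparison =
  fixes r :: real and \<Theta> \<eta> \<zeta> \<kappa> \<mu> :: "real \<Rightarrow> real" and k l :: real
  assumes r: "0 < r"
    and d\<Theta>: "\<And>x. \<bar>x\<bar> < r \<Longrightarrow> (\<Theta> has_real_derivative \<zeta> x / \<eta> x) (at x)"
    and d\<eta>: "\<And>x. \<bar>x\<bar> < r \<Longrightarrow> (\<eta> has_real_derivative - \<kappa> x * x / \<eta> x) (at x)"
    and d\<zeta>: "\<And>x. \<bar>x\<bar> < r \<Longrightarrow> (\<zeta> has_real_derivative - \<mu> x * \<Theta> x / \<eta> x) (at x)"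
    and \<eta>_pos: "\<And>x. \<bar>x\<bar> < r \<Longrightarrow> 0 < \<eta> x"
    and odd: "\<And>x. \<bar>x\<bar> < r \<Longrightarrow> \<Theta> (- x) = - \<Theta> x"
    and \<Theta>_nz: "\<And>x. \<bar>x\<bar> < r \<Longrightarrow> x \<noteq> 0 \<Longrightarrow> \<Theta> x \<noteq> 0"
    and \<zeta>_nz: "\<zeta> 0 \<noteq> 0"
    and d\<kappa>: "(\<kappa> has_real_derivative k) (at 0)"
    and d\<mu>: "(\<mu> has_real_derivative l) (at 0)"
begin

text \<open>This is \<open>\<Theta> - x \<Theta>'\<close>, which inherits oddness from \<open>\<Theta>\<close>; \<open>\<eta>\<close> times it is the Wronskian
  \<open>Z X\<^sub>s - X Z\<^sub>s\<close> of the two solutions. It is of the third order at zero, whereas \<open>\<Theta>\<close> is of the first.\<close>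

definition defect :: "real \<Rightarrow> real" where "defect x = \<Theta> x - x * (\<zeta> x / \<eta> x)"

lemma defect_odd: "\<bar>x\<bar> < r \<Longrightarrow> defect (- x) = - defect x"
  using derivative_parity[of r \<Theta> "\<lambda>x. \<zeta> x / \<eta> x" "-1" x] d\<Theta> odd by (simp add: defect_def)

lemma d_defect:
  assumes "\<bar>x\<bar> < r"
  shows "(defect has_real_derivative x * (((\<mu> x - \<kappa> x) * \<Theta> x + \<kappa> x * defect x) / (\<eta> x)\<^sup>2)) (at x)"
  unfolding defect_def using \<eta>_pos[OF assms]
  by (auto intro!: derivative_eq_intros d\<Theta> d\<eta> d\<zeta> assms simp: field_simps power2_eq_square)

text \<open>The derivative of the defect is even. Written out with the differential equations and divided by
  \<open>x \<Theta>(x)\<close>, this compares the coefficients at the two points \<open>x\<close> and \<open>- x\<close>.\<close>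

lemma defect_symmetry:
  assumes "\<bar>x\<bar> < r" "x \<noteq> 0"
  shows "(\<mu> x - \<kappa> x) / (\<eta> x)\<^sup>2 - (\<mu> (- x) - \<kappa> (- x)) / (\<eta> (- x))\<^sup>2 =
    - (defect x / \<Theta> x) * (\<kappa> x / (\<eta> x)\<^sup>2 - \<kappa> (- x) / (\<eta> (- x))\<^sup>2)"
proof -
  have "(- x) * (((\<mu> (-x) - \<kappa> (-x)) * \<Theta> (-x) + \<kappa> (-x) * defect (-x)) / (\<eta> (-x))\<^sup>2)
     = x * (((\<mu> x - \<kappa> x) * \<Theta> x + \<kappa> x * defect x) / (\<eta> x)\<^sup>2)"
    using derivative_parity[of r defect "\<lambda>x. x * (((\<mu> x - \<kappa> x) * \<Theta> x + \<kappa> x * defect x) / (\<eta> x)\<^sup>2)" "-1" x]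
      d_defect defect_odd assms by simp
  then have "x * (((\<mu> (-x) - \<kappa> (-x)) * \<Theta> x + \<kappa> (-x) * defect x) / (\<eta> (-x))\<^sup>2)
     = x * (((\<mu> x - \<kappa> x) * \<Theta> x + \<kappa> x * defect x) / (\<eta> x)\<^sup>2)"
    using odd[OF assms(1)] defect_odd[OF assms(1)] by (simp add: algebra_simps flip: minus_divide_left)
  then have "((\<mu> (-x) - \<kappa> (-x)) * \<Theta> x + \<kappa> (-x) * defect x) / (\<eta> (-x))\<^sup>2
     = ((\<mu> x - \<kappa> x) * \<Theta> x + \<kappa> x * defect x) / (\<eta> x)\<^sup>2"
    using assms(2) mult_left_cancel by blast
  then have "((\<mu> x - \<kappa> x) / (\<eta> x)\<^sup>2 - (\<mu> (- x) - \<kappa> (- x)) / (\<eta> (- x))\<^sup>2) * \<Theta> x =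
    - defect x * (\<kappa> x / (\<eta> x)\<^sup>2 - \<kappa> (- x) / (\<eta> (- x))\<^sup>2)"
    unfolding add_divide_distrib times_divide_eq_left[symmetric] by algebra
  then show ?thesis using \<Theta>_nz[OF assms] by (simp add: field_simps)
qed

lemma eventually_punctured: "\<forall>\<^sub>F x in at 0. \<bar>x\<bar> < r \<and> x \<noteq> 0"
  using r by (auto simp: eventually_at dist_real_def intro!: exI[of _ r])

lemma defect_ratio: "((\<lambda>x. defect x / \<Theta> x) \<longlongrightarrow> 0) (at 0)"
proof -
  have z: "\<bar>0::real\<bar> < r" using r by simp
  have \<Theta>0: "\<Theta> 0 = 0" using odd[OF z] by simp
  have 1: "((\<lambda>x. \<Theta> x / x) \<longlongrightarrow> \<zeta> 0 / \<eta> 0) (at 0)"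
    using d\<Theta>[OF z] \<Theta>0 by (simp add: DERIV_def)
  have 2: "((\<lambda>x. \<zeta> x / \<eta> x) \<longlongrightarrow> \<zeta> 0 / \<eta> 0) (at 0)"
    using \<eta>_pos[OF z] DERIV_isCont[OF d\<eta>[OF z]] DERIV_isCont[OF d\<zeta>[OF z]]
    by (intro tendsto_divide) (auto simp: isCont_def)
  have 3: "\<zeta> 0 / \<eta> 0 \<noteq> 0" using \<eta>_pos[OF z] \<zeta>_nz by simp
  have "((\<lambda>x. 1 - (\<zeta> x / \<eta> x) / (\<Theta> x / x)) \<longlongrightarrow> 1 - (\<zeta> 0 / \<eta> 0) / (\<zeta> 0 / \<eta> 0)) (at 0)"
    by (rule tendsto_diff[OF tendsto_const tendsto_divide[OF 2 1 3]])
  then have "((\<lambda>x. 1 - (\<zeta> x / \<eta> x) / (\<Theta> x / x)) \<longlongrightarrow> 0) (at 0)"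
    using \<eta>_pos[OF z] \<zeta>_nz by simp
  then show ?thesis
  proof (rule Lim_transform_eventually)
    show "\<forall>\<^sub>F x in at 0. 1 - \<zeta> x / \<eta> x / (\<Theta> x / x) = defect x / \<Theta> x"
      using eventually_punctured
      by eventually_elim (use \<Theta>_nz in \<open>auto simp: defect_def field_simps\<close>)
  qed
qed

text \<open>Divide the preceding identity by \<open>x\<close> and let \<open>x\<close> tend to zero. On the right a bounded quotient is
  multiplied by the ratio of defect and \<open>\<Theta>\<close>, which tends to zero; on the left only \<open>\<mu> - \<kappa>\<close> contributes,
  because \<open>\<eta>'\<close> vanishes at zero.\<close>

lemma derivatives_agree: "l = k"
proof -
  have z: "\<bar>0::real\<bar> < r" using r by simp
  have pos: "0 < \<eta> 0" using \<eta>_pos[OF z] .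
  have d1: "((\<lambda>x. (\<mu> x - \<kappa> x) / (\<eta> x)\<^sup>2) has_real_derivative (l - k) / (\<eta> 0)\<^sup>2) (at 0)"
    using pos by (auto intro!: derivative_eq_intros d\<kappa> d\<mu> d\<eta> z simp: power2_eq_square)
  have d2: "((\<lambda>x. \<kappa> x / (\<eta> x)\<^sup>2) has_real_derivative k / (\<eta> 0)\<^sup>2) (at 0)"
    using pos by (auto intro!: derivative_eq_intros d\<kappa> d\<eta> z simp: power2_eq_square)
  note lim1 = symmetric_difference_quotient[OF d1] and lim2 = symmetric_difference_quotient[OF d2]
  have "((\<lambda>x. - (defect x / \<Theta> x) * ((\<kappa> x / (\<eta> x)\<^sup>2 - \<kappa> (- x) / (\<eta> (- x))\<^sup>2) / x)) \<longlongrightarrow> - 0 * (2 * (k / (\<eta> 0)\<^sup>2))) (at 0)"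
    by (intro tendsto_intros defect_ratio lim2)
  then have "((\<lambda>x. ((\<mu> x - \<kappa> x) / (\<eta> x)\<^sup>2 - (\<mu> (- x) - \<kappa> (- x)) / (\<eta> (- x))\<^sup>2) / x) \<longlongrightarrow> - 0 * (2 * (k / (\<eta> 0)\<^sup>2))) (at 0)"
  proof (rule Lim_transform_eventually)
    show "\<forall>\<^sub>F x in at 0. - (defect x / \<Theta> x) * ((\<kappa> x / (\<eta> x)\<^sup>2 - \<kappa> (- x) / (\<eta> (- x))\<^sup>2) / x) =
       ((\<mu> x - \<kappa> x) / (\<eta> x)\<^sup>2 - (\<mu> (- x) - \<kappa> (- x)) / (\<eta> (- x))\<^sup>2) / x"
      using eventually_punctured
      by eventually_elim (use defect_symmetry in simp)
  qed
  from tendsto_unique[OF _ this lim1] show ?thesis using pos by simp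
qed

text \<open>For constant \<open>\<mu> - \<kappa> = d\<close> the Wronskian \<open>w\<close> satisfies \<open>w' = d x \<Theta> / \<eta>\<close>, hence
  \<open>(w\<^sup>2)' = 2 d x \<Theta> defect\<close>. The right-hand side is odd, so \<open>w\<^sup>2 = \<eta>\<^sup>2 defect\<^sup>2\<close> is even, and since
  \<open>defect\<^sup>2\<close> is even and does not vanish off zero when \<open>d \<noteq> 0\<close>, \<open>\<eta>\<close> is even. Then \<open>\<eta> \<eta>' = - \<kappa> x\<close> shows that
  \<open>\<kappa>\<close> is even too, and an even function has derivative zero at zero.\<close>

lemma stationary:
  assumes diff: "\<And>x. \<bar>x\<bar> < r \<Longrightarrow> \<mu> x - \<kappa> x = d" and d: "d \<noteq> 0"
  shows "k = 0"
proof -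
  define w where "w = (\<lambda>x. \<eta> x * defect x)"
  have dw: "(w has_real_derivative d * x * \<Theta> x / \<eta> x) (at x)" if "\<bar>x\<bar> < r" for x
  proof -
    have "\<mu> x = \<kappa> x + d" using diff[OF that] by simp
    then show ?thesis
      unfolding w_def using \<eta>_pos[OF that]
      by (auto intro!: derivative_eq_intros d_defect d\<eta> that simp: power2_eq_square field_simps)
  qed
  have w0: "w 0 = 0" using odd[of 0] r by (simp add: w_def defect_def)
  have sq: "(w x)\<^sup>2 = (w (- x))\<^sup>2" if x: "\<bar>x\<bar> < r" for x
  proof -
    have "((\<lambda>x. (w x)\<^sup>2 - (w (- x))\<^sup>2) has_real_derivative 0) (at y)" if y: "\<bar>y\<bar> < r" for y
    proof -
      have "((\<lambda>x. w (- x)) has_real_derivative - (d * (- y) * \<Theta> (- y) / \<eta> (- y))) (at y)"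
        using dw[of "- y"] y DERIV_mirror[of w "d * (- y) * \<Theta> (- y) / \<eta> (- y)" y] by simp
      then have "((\<lambda>x. (w x)\<^sup>2 - (w (- x))\<^sup>2) has_real_derivative
          2 * w y * (d * y * \<Theta> y / \<eta> y) + 2 * w (- y) * (d * (- y) * \<Theta> (- y) / \<eta> (- y))) (at y)"
        by (auto intro!: derivative_eq_intros dw y simp: algebra_simps)
      moreover have "2 * w y * (d * y * \<Theta> y / \<eta> y) + 2 * w (- y) * (d * (- y) * \<Theta> (- y) / \<eta> (- y)) = 0"
        using \<eta>_pos[of y] \<eta>_pos[of "- y"] y by (simp add: w_def odd defect_odd)
      ultimately show ?thesis by simp
    qed
    then have "(w x)\<^sup>2 - (w (- x))\<^sup>2 = (w 0)\<^sup>2 - (w (- 0))\<^sup>2"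
      using DERIV_isconst3[of "-r" r x 0 "\<lambda>x. (w x)\<^sup>2 - (w (- x))\<^sup>2"] x r by (auto simp: abs_less_iff)
    then show ?thesis by simp
  qed
  \<comment> \<open>A second zero of \<open>w\<close> would give a zero of \<open>w'\<close> in between, away from the origin.\<close>
  have w_nz: "w x \<noteq> 0" if x: "\<bar>x\<bar> < r" "x \<noteq> 0" for x
  proof
    assume wx: "w x = 0"
    have "\<exists>y. \<bar>y\<bar> < r \<and> y \<noteq> 0 \<and> d * y * \<Theta> y / \<eta> y = 0"
    proof (cases "0 < x")
      case True
      then obtain z where "0 < z" "z < x" "w x - w 0 = (x - 0) * (d * z * \<Theta> z / \<eta> z)"
        using MVT2[of 0 x w "\<lambda>x. d * x * \<Theta> x / \<eta> x"] dw x by auto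
      then show ?thesis using wx w0 x True by (intro exI[of _ z]) auto
    next
      case False
      then have "x < 0" using x by simp
      then obtain z where "x < z" "z < 0" "w 0 - w x = (0 - x) * (d * z * \<Theta> z / \<eta> z)"
        using MVT2[of x 0 w "\<lambda>x. d * x * \<Theta> x / \<eta> x"] dw x by auto
      then show ?thesis using wx w0 x False by (intro exI[of _ z]) auto
    qed
    then show False using d \<Theta>_nz \<eta>_pos by force
  qed
  have even: "\<eta> (- x) = 1 * \<eta> x" if x: "\<bar>x\<bar> < r" for x
  proof (cases "x = 0")
    case False
    have "defect x \<noteq> 0" using w_nz[OF x False] by (simp add: w_def)
    then have "(\<eta> x)\<^sup>2 = (\<eta> (- x))\<^sup>2" using sq[OF x] defect_odd[OF x] by (simp add: w_def power_mult_distrib)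
    then show ?thesis using \<eta>_pos[of x] \<eta>_pos[of "- x"] x by (simp add: power2_eq_iff)
  qed simp
  have sym: "\<kappa> x - \<kappa> (- x) = 0" if x: "\<bar>x\<bar> < r" "x \<noteq> 0" for x
  proof -
    have "- \<kappa> (- x) * (- x) / \<eta> (- x) = - 1 * (- \<kappa> x * x / \<eta> x)"
      by (rule derivative_parity[of r \<eta>]) (use d\<eta> even x in auto)
    then show ?thesis using even[OF x(1)] \<eta>_pos[OF x(1)] x(2) by simp
  qed
  have "((\<lambda>x. 0) \<longlongrightarrow> 2 * k) (at (0::real))"
    using symmetric_difference_quotient[OF d\<kappa>]
  proof (rule Lim_transform_eventually)
    show "\<forall>\<^sub>F x in at 0. (\<kappa> x - \<kappa> (- x)) / x = 0"
      using eventually_punctured by eventually_elim (subst sym, auto)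
  qed
  from LIM_unique[OF this tendsto_const] show ?thesis by simp
qed

end

section \<open>Barycenters and the functional equation\<close>

definition barycenter :: "(real \<Rightarrow> real) \<Rightarrow> real \<Rightarrow> real \<Rightarrow> real" where
  "barycenter p u v = (u * p u + v * p v) / (p u + p v)"

lemma barycenter_commute: "barycenter p u v = barycenter p v u"
  by (simp add: barycenter_def add.commute)

lemma barycenter_diff:
  assumes "0 < p u" "0 < p v"
  shows "u - barycenter p u v = p v * (u - v) / (p u + p v)"
    and "barycenter p u v - v = p u * (u - v) / (p u + p v)"
proof -
  have "p u + p v \<noteq> 0" using assms by simp
  then show "u - barycenter p u v = p v * (u - v) / (p u + p v)"
    and "barycenter p u v - v = p u * (u - v) / (p u + p v)"
    by (simp_all add: barycenter_def field_simps)
qed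

lemma barycenter_balance:
  assumes "0 < p u" "0 < p v"
  shows "p u * (u - barycenter p u v) + p v * (v - barycenter p u v) = 0"
proof -
  have "p u + p v \<noteq> 0" using assms by simp
  then show ?thesis by (simp add: barycenter_def field_simps)
qed

lemma barycenter_unique:
  assumes "0 < p u" "0 < p v" "p u * (u - m) + p v * (v - m) = 0"
  shows "barycenter p u v = m"
  using assms by (simp add: barycenter_def field_simps)

lemma barycenter_between:
  assumes "0 < p u" "0 < p v" "u < v"
  shows "u < barycenter p u v" "barycenter p u v < v"
proof -
  have "p v * (u - v) / (p u + p v) < 0" "p u * (u - v) / (p u + p v) < 0"
    using assms by (auto intro!: divide_neg_pos mult_pos_neg)
  then show "u < barycenter p u v" "barycenter p u v < v"
    using barycenter_diff[of p u v] assms(1,2) by linarith+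
qed

lemma barycenter_same: "0 < p u \<Longrightarrow> barycenter p u u = u"
  by (simp add: barycenter_def field_simps)

lemma barycenter_neq:
  assumes "0 < p u" "0 < p v" "u \<noteq> v"
  shows "barycenter p u v \<noteq> u" "barycenter p u v \<noteq> v"
  using assms barycenter_between[of p u v] barycenter_between[of p v u] barycenter_commute[of p u v]
  by (cases "u < v"; force)+

lemma barycenter_mem:
  assumes "is_interval J" "u \<in> J" "v \<in> J" "0 < p u" "0 < p v"
  shows "barycenter p u v \<in> J"
proof -
  have "\<lbrakk>x \<in> J; y \<in> J; x < z; z < y\<rbrakk> \<Longrightarrow> z \<in> J" for x y z
    using assms(1) by (meson is_interval_1 less_imp_le)
  then show ?thesis
    using assms(2-) barycenter_between[of p u v] barycenter_between[of p v u]
      barycenter_commute[of p u v] barycenter_same[of p u]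
    by (cases u v rule: linorder_cases) metis+
qed

text \<open>The hypotheses on \<open>J\<close>, \<open>p\<close>, \<open>\<phi>\<close>, \<open>\<psi>\<close>. The condition that \<open>(\<phi> / \<psi>)'\<close> does not vanish appears as
  \<open>W \<noteq> 0\<close>, since \<open>(\<phi> / \<psi>)' = W / \<psi>\<^sup>2\<close>.\<close>

locale mean_pair =
  fixes J :: "real set" and p \<phi> \<psi> :: "real \<Rightarrow> real"
  assumes open_J: "open J" and interval_J: "is_interval J"
    and p_cont: "continuous_on J p" and p_pos: "\<And>u. u \<in> J \<Longrightarrow> 0 < p u"
    and D\<phi>: "\<And>u. u \<in> J \<Longrightarrow> (\<phi> has_real_derivative deriv \<phi> u) (at u)"
    and D\<psi>: "\<And>u. u \<in> J \<Longrightarrow> (\<psi> has_real_derivative deriv \<psi> u) (at u)"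
    and d\<phi>_cont: "continuous_on J (deriv \<phi>)" and d\<psi>_cont: "continuous_on J (deriv \<psi>)"
    and \<psi>_pos: "\<And>u. u \<in> J \<Longrightarrow> 0 < \<psi> u"
    and wronskian_nz: "\<And>u. u \<in> J \<Longrightarrow> wronskian \<phi> \<psi> u \<noteq> 0"
begin

abbreviation "m \<equiv> barycenter p"
abbreviation "W \<equiv> wronskian \<phi> \<psi>"

lemma mem: "u \<in> J \<Longrightarrow> v \<in> J \<Longrightarrow> m u v \<in> J"
  by (intro barycenter_mem interval_J p_pos)

lemma cont_at:
  assumes "u \<in> J"
  shows "isCont p u" "isCont (deriv \<phi>) u" "isCont (deriv \<psi>) u" "isCont \<phi> u" "isCont \<psi> u" "isCont W u"
proof -
  show *: "isCont p u" "isCont (deriv \<phi>) u" "isCont (deriv \<psi>) u" "isCont \<phi> u" "isCont \<psi> u"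
    using assms p_cont d\<phi>_cont d\<psi>_cont open_J DERIV_isCont[OF D\<phi>[OF assms]] DERIV_isCont[OF D\<psi>[OF assms]]
    by (auto simp: continuous_on_eq_continuous_at)
  show "isCont W u" unfolding wronskian_def[abs_def]
    by (intro continuous_intros *)
qed

lemma m_cont: "u \<in> J \<Longrightarrow> v \<in> J \<Longrightarrow> isCont (\<lambda>x. m x v) u"
  unfolding barycenter_def using p_pos[of u] p_pos[of v]
  by (intro continuous_intros cont_at) auto

lemma m_cont': "u \<in> J \<Longrightarrow> v \<in> J \<Longrightarrow> isCont (m u) v"
  using m_cont[of v u] by (simp add: barycenter_commute[of p _ u])

lemma exists_other:
  assumes "u \<in> J" obtains v where "v \<in> J" "v \<noteq> u"
proof -
  from open_J assms obtain e where "0 < e" "ball u e \<subseteq> J" by (meson open_contains_ball)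
  then have "u + e/2 \<in> J" by (auto simp: dist_real_def subset_iff)
  then show ?thesis using that[of "u + e/2"] \<open>0 < e\<close> by simp
qed

lemma constant_on_J:
  assumes "\<And>u. u \<in> J \<Longrightarrow> (f has_real_derivative 0) (at u)"
  shows "\<exists>c. \<forall>u\<in>J. f u = c"
  using has_field_derivative_zero_constant[of J f] assms interval_J is_interval_convex
  by (metis DERIV_subset subset_UNIV)

lemma D_ratio: "u \<in> J \<Longrightarrow> ((\<lambda>x. \<phi> x / \<psi> x) has_real_derivative W u / (\<psi> u)\<^sup>2) (at u)"
  using \<psi>_pos[of u] unfolding wronskian_def
  by (auto intro!: derivative_eq_intros D\<phi> D\<psi> simp: power2_eq_square)

lemma inj_ratio: "inj_on (\<lambda>x. \<phi> x / \<psi> x) J"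
proof (rule linorder_inj_onI)
  fix a b assume ab: "a < b" "a \<in> J" "b \<in> J"
  then have sub: "c \<in> J" if "a \<le> c" "c \<le> b" for c
    using that interval_J by (meson is_interval_1)
  obtain z where z: "a < z" "z < b" "\<phi> b / \<psi> b - \<phi> a / \<psi> a = (b - a) * (W z / (\<psi> z)\<^sup>2)"
    using MVT2[of a b "\<lambda>x. \<phi> x / \<psi> x" "\<lambda>x. W x / (\<psi> x)\<^sup>2"] ab sub D_ratio by blast
  then have "W z / (\<psi> z)\<^sup>2 \<noteq> 0" using wronskian_nz[OF sub[of z]] \<psi>_pos[OF sub[of z]] by auto
  then show "\<phi> a / \<psi> a \<noteq> \<phi> b / \<psi> b" using z ab by auto
qed auto

lemma ratio_equation_iff:
  assumes "u \<in> J" "v \<in> J" "x \<in> J"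
  shows "\<phi> x / \<psi> x = (\<phi> u + \<phi> v) / (\<psi> u + \<psi> v) \<longleftrightarrow> \<phi> x * (\<psi> u + \<psi> v) = \<psi> x * (\<phi> u + \<phi> v)"
  using \<psi>_pos[OF assms(1)] \<psi>_pos[OF assms(2)] \<psi>_pos[OF assms(3)]
  by (subst frac_eq_eq) (auto simp: mult.commute)

text \<open>The quotient is a convex combination of the values of \<open>\<phi> / \<psi>\<close> at \<open>u\<close> and \<open>v\<close>, with weights
  \<open>\<psi>(u)\<close> and \<open>\<psi>(v)\<close>, so it lies in the image of the interval. This is what makes the inverse in the
  definition of the mean meaningful.\<close>

lemma mean_value_attained:
  assumes u: "u \<in> J" and v: "v \<in> J"
  shows "(\<phi> u + \<phi> v) / (\<psi> u + \<psi> v) \<in> (\<lambda>x. \<phi> x / \<psi> x) ` J"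
proof -
  let ?F = "\<lambda>x. \<phi> x / \<psi> x"
  have pos: "0 < \<psi> u" "0 < \<psi> v" using \<psi>_pos u v by auto
  have "continuous_on J ?F"
    using D_ratio by (meson DERIV_isCont continuous_at_imp_continuous_on)
  then have con: "connected (?F ` J)"
    using connected_continuous_image interval_J is_interval_connected by blast
  have le: "?F a \<le> (\<phi> a + \<phi> b) / (\<psi> a + \<psi> b) \<and> (\<phi> a + \<phi> b) / (\<psi> a + \<psi> b) \<le> ?F b"
    if "?F a \<le> ?F b" "0 < \<psi> a" "0 < \<psi> b" for a b
  proof -
    have "\<phi> a * \<psi> b \<le> \<phi> b * \<psi> a" using that by (simp add: field_simps)
    then show ?thesis using that(2,3) by (simp add: field_simps)
  qed
  show ?thesis
  proof (cases "?F u \<le> ?F v")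
    case True
    then show ?thesis
      using connected_contains_Icc[OF con, of "?F u" "?F v"] le[OF True pos] u v
      by (auto simp: subset_iff)
  next
    case False
    then have "?F v \<le> ?F u" by simp
    from connected_contains_Icc[OF con, of "?F v" "?F u"] le[OF this pos(2,1)] u v show ?thesis
      by (auto simp: subset_iff add.commute)
  qed
qed

lemma means_eq_iff:
  assumes u: "u \<in> J" and v: "v \<in> J" and q: "\<And>x. x \<in> J \<Longrightarrow> q x = x * p x"
  shows "bajraktarevic_mean J q p u v = bajraktarevic_mean J \<phi> \<psi> u v \<longleftrightarrow>
    \<phi> (m u v) * (\<psi> u + \<psi> v) = \<psi> (m u v) * (\<phi> u + \<phi> v)"
proof -
  have id: "q x / p x = x" if "x \<in> J" for x using q[OF that] p_pos[OF that] by simp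
  then have "inj_on (\<lambda>x. q x / p x) J" by (simp add: inj_on_def)
  moreover have "m u v = (q u + q v) / (p u + p v)" using q u v by (simp add: barycenter_def)
  ultimately have 1: "bajraktarevic_mean J q p u v = m u v"
    unfolding bajraktarevic_mean_def using mem[OF u v] id[OF mem[OF u v]]
    by (intro inv_into_f_eq) auto
  let ?y = "(\<phi> u + \<phi> v) / (\<psi> u + \<psi> v)"
  have "inv_into J (\<lambda>x. \<phi> x / \<psi> x) ?y = m u v \<longleftrightarrow> \<phi> (m u v) / \<psi> (m u v) = ?y"
    using inv_into_f_eq[OF inj_ratio mem[OF u v]] f_inv_into_f[OF mean_value_attained[OF u v]] by auto
  moreover have "bajraktarevic_mean J \<phi> \<psi> u v = inv_into J (\<lambda>x. \<phi> x / \<psi> x) ?y"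
    by (simp add: bajraktarevic_mean_def)
  ultimately show ?thesis using 1 ratio_equation_iff[OF u v mem[OF u v]] by metis
qed

text \<open>The points at which \<open>(\<phi>, \<psi>)\<close> coincides with the image of \<open>(q, p)\<close> under the matrix with rows \<open>(a, b)\<close> and
  \<open>(c, d)\<close>. It is a set, and not a condition on all of \<open>J\<close>, because agreement is first found locally
  and then propagated.\<close>

definition agreement :: "real \<Rightarrow> real \<Rightarrow> real \<Rightarrow> real \<Rightarrow> real set" where
  "agreement a b c d = {x \<in> J. \<phi> x = p x * (a * x + b) \<and> \<psi> x = p x * (c * x + d)}"

lemma cross_nz: "x \<in> J \<Longrightarrow> u \<in> J \<Longrightarrow> x \<noteq> u \<Longrightarrow> \<phi> x * \<psi> u - \<phi> u * \<psi> x \<noteq> 0"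
  using inj_ratio[unfolded inj_on_def, rule_format, of x u] \<psi>_pos[of x] \<psi>_pos[of u]
  by (auto simp: field_simps)

text \<open>Agreement at two points already excludes a singular matrix, as it would make \<open>\<phi> / \<psi>\<close> take the same value
  at both.\<close>

lemma agreement_det:
  assumes "x \<in> agreement a b c d" "y \<in> agreement a b c d" "x \<noteq> y"
  shows "a * d - b * c \<noteq> 0"
proof
  assume "a * d - b * c = 0"
  moreover have "\<phi> x * \<psi> y - \<phi> y * \<psi> x = p x * p y * ((a * d - b * c) * (x - y))"
    using assms unfolding agreement_def by (simp add: algebra_simps)
  ultimately show False using cross_nz[of x y] assms by (simp add: agreement_def)
qed

lemma equation_of_agreement:
  assumes "agreement a b c d = J" and u: "u \<in> J" and v: "v \<in> J"
  shows "\<phi> (m u v) * (\<psi> u + \<psi> v) = \<psi> (m u v) * (\<phi> u + \<phi> v)"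
proof -
  have *: "\<phi> x = p x * (a * x + b) \<and> \<psi> x = p x * (c * x + d)" if "x \<in> J" for x
    using that assms(1) unfolding agreement_def by blast
  have "p u + p v \<noteq> 0" using p_pos[OF u] p_pos[OF v] by simp
  then have "u * p u + v * p v = m u v * (p u + p v)" by (simp add: barycenter_def)
  moreover note *[OF u] *[OF v] *[OF mem[OF u v]]
  ultimately show ?thesis by algebra
qed

end

section \<open>First derivatives and the Wronskian\<close>

locale mean_equation = mean_pair +
  assumes equation: "\<And>u v. u \<in> J \<Longrightarrow> v \<in> J \<Longrightarrow>
      \<phi> (barycenter p u v) * (\<psi> u + \<psi> v) = \<psi> (barycenter p u v) * (\<phi> u + \<phi> v)"
begin

lemma ratio_equation:
  assumes "u \<in> J" "v \<in> J"
  shows "\<phi> (m u v) / \<psi> (m u v) = (\<phi> u + \<phi> v) / (\<psi> u + \<psi> v)"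
  using equation[OF assms] ratio_equation_iff[OF assms mem[OF assms]] by simp

text \<open>By the functional equation \<open>\<phi> / \<psi>\<close> maps \<open>m(x, v)\<close> to a differentiable function of \<open>x\<close>, and \<open>\<phi> / \<psi>\<close>
  has a nonzero derivative. So \<open>m\<close> is differentiable in \<open>x\<close> although \<open>p\<close> is only known to be continuous.\<close>

lemma m_deriv_\<phi>\<psi>:
  assumes u: "u \<in> J" and v: "v \<in> J"
  shows "((\<lambda>x. m x v) has_real_derivative
    (deriv \<phi> u * \<psi> (m u v) - deriv \<psi> u * \<phi> (m u v)) * \<psi> (m u v) / ((\<psi> u + \<psi> v) * W (m u v))) (at u)"
proof -
  let ?m = "m u v"
  have pos: "0 < \<psi> ?m" "0 < \<psi> u" "0 < \<psi> v" using \<psi>_pos u v mem by auto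
  have W: "W ?m \<noteq> 0" using wronskian_nz mem u v by auto
  let ?E = "(deriv \<phi> u * (\<psi> u + \<psi> v) - (\<phi> u + \<phi> v) * deriv \<psi> u) / (\<psi> u + \<psi> v)\<^sup>2"
  have "((\<lambda>x. (\<phi> x + \<phi> v) / (\<psi> x + \<psi> v)) has_real_derivative ?E) (at u)"
    using pos u by (auto intro!: derivative_eq_intros D\<phi> D\<psi> simp: power2_eq_square)
  then have "((\<lambda>x. \<phi> (m x v) / \<psi> (m x v)) has_real_derivative ?E) (at u)"
    by (rule has_field_derivative_transform_within_open[OF _ open_J u]) (simp add: ratio_equation v)
  from DERIV_cancel_outer[where g = "\<lambda>x. m x v", OF D_ratio[OF mem[OF u v]] _ m_cont[OF u v] this]
  have "((\<lambda>x. m x v) has_real_derivative ?E / (W ?m / (\<psi> ?m)\<^sup>2)) (at u)"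
    using W pos by simp
  moreover have "?E / (W ?m / (\<psi> ?m)\<^sup>2) = (deriv \<phi> u * \<psi> ?m - deriv \<psi> u * \<phi> ?m) * \<psi> ?m / ((\<psi> u + \<psi> v) * W ?m)"
  proof -
    have "?E = (deriv \<phi> u - deriv \<psi> u * ((\<phi> u + \<phi> v) / (\<psi> u + \<psi> v))) / (\<psi> u + \<psi> v)"
      using pos by (simp add: field_simps power2_eq_square)
    also have "\<dots> = (deriv \<phi> u - deriv \<psi> u * (\<phi> ?m / \<psi> ?m)) / (\<psi> u + \<psi> v)"
      by (simp only: ratio_equation[OF u v])
    finally have E: "?E = (deriv \<phi> u - deriv \<psi> u * (\<phi> ?m / \<psi> ?m)) / (\<psi> u + \<psi> v)" .
    have alg: "(a - b * (f / c)) / S / (w / c\<^sup>2) = (a * c - b * f) * c / (S * w)"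
      if "c \<noteq> 0" "S \<noteq> 0" "w \<noteq> 0" for a b c f S w :: real
      using that by (simp add: field_simps power2_eq_square)
    show ?thesis unfolding E by (rule alg) (use W pos in auto)
  qed
  ultimately show ?thesis by simp
qed

text \<open>The weight recovered from the mean: for fixed \<open>v\<close> this transfers the regularity of \<open>m\<close> to \<open>p\<close>, at every
  point other than \<open>v\<close>.\<close>

lemma p_quotient:
  assumes "u \<in> J" "v \<in> J" "u \<noteq> v"
  shows "p u = p v * (m u v - v) / (u - m u v)"
proof -
  have "p u * (u - m u v) = p v * (m u v - v)"
    using barycenter_balance[of p u v] p_pos assms by (simp add: algebra_simps)
  moreover have "u - m u v \<noteq> 0" using barycenter_neq[of p u v] p_pos assms by auto
  ultimately show ?thesis by (simp add: eq_divide_eq)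
qed

lemma Dp:
  assumes u: "u \<in> J"
  shows "(p has_real_derivative deriv p u) (at u)"
proof -
  obtain v where v: "v \<in> J" "v \<noteq> u" using exists_other[OF u] .
  have ne: "u - m u v \<noteq> 0" using barycenter_neq[of p u v] p_pos u v by auto
  obtain E where E: "((\<lambda>x. m x v) has_real_derivative E) (at u)" using m_deriv_\<phi>\<psi>[OF u v(1)] by blast
  have "((\<lambda>x. p v * (m x v - v) / (x - m x v)) has_real_derivative
      ((p v * E) * (u - m u v) - (p v * (m u v - v)) * (1 - E)) / ((u - m u v) * (u - m u v))) (at u)"
    using ne by (auto intro!: derivative_eq_intros E)
  then have "(p has_real_derivative
      ((p v * E) * (u - m u v) - (p v * (m u v - v)) * (1 - E)) / ((u - m u v) * (u - m u v))) (at u)"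
  proof (rule has_field_derivative_transform_within_open)
    show "open (J - {v})" "u \<in> J - {v}" using open_J u v by (auto intro: open_delete)
    show "p v * (m x v - v) / (x - m x v) = p x" if "x \<in> J - {v}" for x
      using p_quotient[of x v] that v by simp
  qed
  then show ?thesis by (metis DERIV_imp_deriv)
qed

lemma m_deriv_p:
  assumes u: "u \<in> J" and v: "v \<in> J"
  shows "((\<lambda>x. m x v) has_real_derivative (p u + (u - m u v) * deriv p u) / (p u + p v)) (at u)"
proof -
  have S: "p u + p v \<noteq> 0" using p_pos[OF u] p_pos[OF v] by simp
  have "((\<lambda>x. (x * p x + v * p v) / (p x + p v)) has_real_derivative
      ((p u + u * deriv p u) * (p u + p v) - (u * p u + v * p v) * deriv p u) / ((p u + p v) * (p u + p v))) (at u)"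
    using S by (auto intro!: derivative_eq_intros Dp u)
  moreover have "((p u + u * deriv p u) * (p u + p v) - (u * p u + v * p v) * deriv p u) / ((p u + p v) * (p u + p v))
     = (p u + (u - m u v) * deriv p u) / (p u + p v)"
  proof -
    have "u * p u + v * p v = m u v * (p u + p v)" using S by (simp add: barycenter_def)
    then have "(p u + u * deriv p u) * (p u + p v) - (u * p u + v * p v) * deriv p u
       = (p u + (u - m u v) * deriv p u) * (p u + p v)" by algebra
    then show ?thesis using S by simp
  qed
  ultimately show ?thesis by (simp add: barycenter_def)
qed

lemma m_deriv_p':
  assumes u: "u \<in> J" and v: "v \<in> J"
  shows "((\<lambda>x. m u x) has_real_derivative (p v + (v - m u v) * deriv p v) / (p u + p v)) (at v)"
  using m_deriv_p[OF v u] by (simp add: barycenter_commute add.commute)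

text \<open>The functional equation differentiated in \<open>u\<close>: the two expressions for the derivative of \<open>m\<close>, one
  through \<open>p\<close> and one through \<open>\<phi>, \<psi>\<close>, are equal.\<close>

lemma first_order_equation:
  assumes u: "u \<in> J" and v: "v \<in> J"
  shows "W (m u v) * (p u + (u - m u v) * deriv p u) * (\<psi> u + \<psi> v) =
    (deriv \<phi> u * \<psi> (m u v) - deriv \<psi> u * \<phi> (m u v)) * \<psi> (m u v) * (p u + p v)"
proof -
  have "(p u + (u - m u v) * deriv p u) / (p u + p v) =
    (deriv \<phi> u * \<psi> (m u v) - deriv \<psi> u * \<phi> (m u v)) * \<psi> (m u v) / ((\<psi> u + \<psi> v) * W (m u v))"
    by (rule DERIV_unique[OF m_deriv_p[OF u v] m_deriv_\<phi>\<psi>[OF u v]])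
  moreover have "p u + p v \<noteq> 0" "\<psi> u + \<psi> v \<noteq> 0" "W (m u v) \<noteq> 0"
    using p_pos[OF u] p_pos[OF v] \<psi>_pos[OF u] \<psi>_pos[OF v] wronskian_nz[OF mem[OF u v]] by auto
  ultimately have "(p u + (u - m u v) * deriv p u) * ((\<psi> u + \<psi> v) * W (m u v)) =
    ((deriv \<phi> u * \<psi> (m u v) - deriv \<psi> u * \<phi> (m u v)) * \<psi> (m u v)) * (p u + p v)"
    by (subst (asm) frac_eq_eq) auto
  then show ?thesis by (simp only: ac_simps)
qed

lemma dp_cont:
  assumes u: "u \<in> J"
  shows "isCont (deriv p) u"
proof -
  obtain v where v: "v \<in> J" "v \<noteq> u" using exists_other[OF u] .
  have ne: "x - m x v \<noteq> 0" if "x \<in> J - {v}" for x using barycenter_neq[of p x v] p_pos that v by auto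
  let ?h = "\<lambda>x. ((deriv \<phi> x * \<psi> (m x v) - deriv \<psi> x * \<phi> (m x v)) * \<psi> (m x v) * (p x + p v) /
      (W (m x v) * (\<psi> x + \<psi> v)) - p x) / (x - m x v)"
  have nz: "W (m u v) * (\<psi> u + \<psi> v) \<noteq> 0"
    using \<psi>_pos[OF u] \<psi>_pos[OF v(1)] wronskian_nz[OF mem[OF u v(1)]] by simp
  have "isCont ?h u"
    using ne[of u] nz u v(1,2)
    by (intro continuous_intros cont_at isCont_o2[where g = \<psi>, OF m_cont] isCont_o2[where g = \<phi>, OF m_cont]
        isCont_o2[where g = W, OF m_cont] m_cont mem) auto
  moreover have "\<forall>\<^sub>F x in nhds u. ?h x = deriv p x"
  proof -
    have "\<forall>\<^sub>F x in nhds u. x \<in> J - {v}"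
      using open_J u v by (intro eventually_nhds_in_open) auto
    then show ?thesis
    proof eventually_elim
      case (elim x)
      have "W (m x v) * (\<psi> x + \<psi> v) \<noteq> 0"
        using \<psi>_pos[of x] \<psi>_pos[OF v(1)] wronskian_nz[OF mem[of x v]] v elim by simp
      then have "(deriv \<phi> x * \<psi> (m x v) - deriv \<psi> x * \<phi> (m x v)) * \<psi> (m x v) * (p x + p v) /
        (W (m x v) * (\<psi> x + \<psi> v)) = p x + (x - m x v) * deriv p x"
        using first_order_equation[of x v] elim v by (simp add: field_simps)
      then show ?case using ne[OF elim] by simp
    qed
  qed
  ultimately show ?thesis by (simp add: isCont_cong)
qed

text \<open>For fixed \<open>u\<close> the first-order equation reads \<open>W(m(u, v)) = N(v) / M(v)\<close>. Here \<open>N\<close> and \<open>M\<close> contain no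
  derivative taken at \<open>v\<close> or at \<open>m(u, v)\<close>, so they are differentiable in \<open>v\<close> although \<open>\<phi>\<close>, \<open>\<psi>\<close>, \<open>p\<close> are
  only \<open>C\<^sup>1\<close>. Since \<open>v \<mapsto> m(u, v)\<close> has derivative \<open>1 / 2\<close> at \<open>v = u\<close>, it can be inverted near \<open>u\<close>; this
  gives the derivative of \<open>W\<close> at \<open>u\<close> as twice that of \<open>N / M\<close>.\<close>

lemma wronskian_deriv:
  assumes u: "u \<in> J"
  shows "(W has_real_derivative 2 * W u * deriv p u / p u) (at u)"
proof -
  have [simp]: "m u u = u" using barycenter_same p_pos u by blast
  have pos: "0 < p u" "0 < \<psi> u" using p_pos \<psi>_pos u by auto
  have dm: "((\<lambda>v. m u v) has_real_derivative 1/2) (at u)"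
    using m_deriv_p'[OF u u] pos by simp
  have d1: "((\<lambda>v. \<phi> (m u v)) has_real_derivative deriv \<phi> u * (1/2)) (at u)"
    by (rule DERIV_chain2[OF _ dm]) (simp add: D\<phi> u)
  have d2: "((\<lambda>v. \<psi> (m u v)) has_real_derivative deriv \<psi> u * (1/2)) (at u)"
    by (rule DERIV_chain2[OF _ dm]) (simp add: D\<psi> u)
  define N where "N = (\<lambda>v. (deriv \<phi> u * \<psi> (m u v) - deriv \<psi> u * \<phi> (m u v)) * \<psi> (m u v) * (p u + p v))"
  define M where "M = (\<lambda>v. (p u + (u - m u v) * deriv p u) * (\<psi> u + \<psi> v))"
  have dN: "(N has_real_derivative W u * (deriv \<psi> u * p u + \<psi> u * deriv p u)) (at u)"
    unfolding N_def wronskian_def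
    by (auto intro!: derivative_eq_intros d1 d2 Dp u simp: field_simps)
  have dM: "(M has_real_derivative p u * deriv \<psi> u - \<psi> u * deriv p u) (at u)"
    unfolding M_def
    by (auto intro!: derivative_eq_intros dm D\<psi> u simp: field_simps)
  have Mu: "M u = 2 * p u * \<psi> u" "N u = 2 * p u * \<psi> u * W u"
    by (simp_all add: M_def N_def wronskian_def algebra_simps)
  have dR: "((\<lambda>v. N v / M v) has_real_derivative W u * deriv p u / p u) (at u)"
    using Mu pos
    by (auto intro!: derivative_eq_intros dN dM simp: field_simps power2_eq_square)
  let ?dm = "\<lambda>v. (p v + (v - m u v) * deriv p v) / (p u + p v)"
  have "isCont ?dm u"
    using pos u by (intro continuous_intros cont_at dp_cont DERIV_isCont[OF dm]) auto
  moreover have "?dm u \<noteq> 0" using pos by simp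
  ultimately obtain r g where "0 < r" "g (m u u) = u" and
      g: "\<And>y. \<bar>y - m u u\<bar> < r \<Longrightarrow> g y \<in> J \<and> m u (g y) = y \<and> 0 < ?dm u * ?dm (g y) \<and>
            (g has_real_derivative inverse (?dm (g y))) (at y)"
    using real_local_inverse[of J u "m u" ?dm] open_J u m_deriv_p'[OF u] by blast
  then have rg: "0 < r" "g u = u" "\<And>y. \<bar>y - u\<bar> < r \<Longrightarrow> g y \<in> J \<and> m u (g y) = y"
    by auto
  have dgu: "(g has_real_derivative 2) (at u)" using g[of u] rg pos by simp
  have "isCont (\<lambda>y. M (g y)) u"
    by (rule isCont_o2[OF DERIV_isCont[OF dgu]]) (simp add: rg(2) DERIV_isCont[OF dM])
  moreover have "M (g u) \<noteq> 0" using rg Mu pos by simp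
  ultimately have "\<forall>\<^sub>F y in at u. M (g y) \<noteq> 0"
    unfolding isCont_def by (rule tendsto_imp_eventually_ne)
  then have "\<forall>\<^sub>F y in nhds u. M (g y) \<noteq> 0"
    using \<open>M (g u) \<noteq> 0\<close> unfolding eventually_nhds_conv_at by blast
  moreover have "\<forall>\<^sub>F y in nhds u. \<bar>y - u\<bar> < r"
    using rg(1) by (auto simp: eventually_nhds_metric dist_real_def)
  ultimately have ev: "\<forall>\<^sub>F y in nhds u. W y = N (g y) / M (g y)"
  proof eventually_elim
    case (elim y)
    then have "W y * M (g y) = N (g y)"
      using first_order_equation[OF u, of "g y"] rg(3)[of y] by (simp add: M_def N_def algebra_simps)
    then show ?case using elim by (simp add: field_simps)
  qed
  have "((\<lambda>y. N (g y) / M (g y)) has_real_derivative (W u * deriv p u / p u) * 2) (at u)"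
    by (rule DERIV_chain2[of "\<lambda>v. N v / M v", OF _ dgu]) (simp add: rg dR)
  then have "(W has_real_derivative (W u * deriv p u / p u) * 2) (at u)"
    using DERIV_cong_ev[OF refl ev refl] by blast
  then show ?thesis by (simp add: ac_simps)
qed

lemma wronskian_proportional: "\<exists>\<gamma>. \<forall>u\<in>J. W u = \<gamma> * (p u)\<^sup>2"
proof -
  have "((\<lambda>u. W u / (p u)\<^sup>2) has_real_derivative 0) (at u)" if u: "u \<in> J" for u
    using p_pos[OF u]
    by (auto intro!: derivative_eq_intros wronskian_deriv u Dp simp: field_simps power2_eq_square)
  then obtain c where "\<And>u. u \<in> J \<Longrightarrow> W u / (p u)\<^sup>2 = c"
    using constant_on_J[of "\<lambda>u. W u / (p u)\<^sup>2"] by blast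
  then show ?thesis using p_pos by (intro exI[of _ c]) (force simp: field_simps)
qed

end

section \<open>Agreement up to a linear transformation\<close>

context mean_equation
begin

text \<open>Agreement spreads beyond an interval: for \<open>v\<close> close to \<open>e\<close> choose \<open>r\<close> in the interval such that
  \<open>m(r, v)\<close> lies in it as well. The functional equation is then one linear equation for the deviations
  of \<open>\<phi>(v)\<close> and \<open>\<psi>(v)\<close> from their expected values. Two values \<open>s, t\<close> of \<open>r\<close> with different \<open>m(r, v)\<close> give
  a regular system, so the deviations vanish.\<close>

lemma agreement_step:
  assumes xy: "x < y" "{x..y} \<subseteq> agreement a b c d" and e: "e \<in> {x..y}"
  shows "\<forall>\<^sub>F v in nhds e. v \<in> agreement a b c d"
proof -
  have J: "z \<in> J" if "z \<in> {x..y}" for z using that xy by (auto simp: agreement_def)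
  have det: "a * d - b * c \<noteq> 0" using xy by (intro agreement_det[of x _ _ _ _ y]) auto
  obtain s where s: "x < s" "s < y" "s \<noteq> e"
  proof (cases "e = (x + y) / 2")
    case True
    then show ?thesis using that[of "(3 * x + y) / 4"] xy by (auto simp: field_simps)
  next
    case False
    then show ?thesis using that[of "(x + y) / 2"] xy by (auto simp: field_simps)
  qed
  have between: "x < m r e" "m r e < y" "m r e \<noteq> r" "m r e \<noteq> e" if "x < r" "r < y" "r \<noteq> e" for r
    using barycenter_between[of p r e] barycenter_between[of p e r] barycenter_commute[of p e r]
      p_pos[OF J, of r] p_pos[OF J, of e] that e by (cases "r < e"; force)+
  \<comment> \<open>With this \<open>t\<close> the value \<open>m(t, e)\<close> lies strictly between \<open>t = m(s, e)\<close> and \<open>e\<close>, so it differs from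
    \<open>m(s, e)\<close>.\<close>
  define t where "t = m s e"
  have t: "x < t" "t < y" "t \<noteq> e" "t \<noteq> s" using between[OF s] by (auto simp: t_def)
  have lims: "((\<lambda>v. m s v) \<longlongrightarrow> m s e) (nhds e)" "((\<lambda>v. m t v) \<longlongrightarrow> m t e) (nhds e)"
    using m_cont'[of s e, THEN isCont_tendsto_nhds] m_cont'[of t e, THEN isCont_tendsto_nhds] J e s t
    by auto
  have ne: "m s e - m t e \<noteq> 0" using between(3)[OF t(1-3)] by (simp add: t_def)
  have "((\<lambda>v. m s v - m t v) \<longlongrightarrow> m s e - m t e) (nhds e)" by (intro tendsto_diff lims)
  note ev = tendsto_imp_eventually_ne[OF this ne]
    order_tendstoD(1)[OF lims(1) between(1)[OF s]] order_tendstoD(2)[OF lims(1) between(2)[OF s]]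
    order_tendstoD(1)[OF lims(2) between(1)[OF t(1-3)]] order_tendstoD(2)[OF lims(2) between(2)[OF t(1-3)]]
  have "\<forall>\<^sub>F v in nhds e. v \<in> J" using open_J J[OF e] by (rule eventually_nhds_in_open)
  with ev show ?thesis
  proof eventually_elim
    case (elim v)
    define f where "f = \<phi> v - p v * (a * v + b)"
    define h where "h = \<psi> v - p v * (c * v + d)"
    have rel: "(a * m r v + b) * h = (c * m r v + d) * f"
      if r: "x < r" "r < y" and mr: "x < m r v" "m r v < y" for r
    proof -
      let ?M = "m r v"
      have rJ: "r \<in> J" using J r by auto
      have M: "?M \<in> agreement a b c d" and R: "r \<in> agreement a b c d"
        using r mr xy(2) by (auto simp: subset_iff)
      have pM: "0 < p ?M" using M p_pos by (auto simp: agreement_def)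
      have "(p ?M * (a * ?M + b)) * (p r * (c * r + d) + \<psi> v) = (p ?M * (c * ?M + d)) * (p r * (a * r + b) + \<phi> v)"
        using equation[of r v] M R rJ elim by (simp add: agreement_def)
      then have 1: "(a * ?M + b) * (p r * (c * r + d) + \<psi> v) = (c * ?M + d) * (p r * (a * r + b) + \<phi> v)"
        using pM by simp
      have "p r + p v \<noteq> 0" using p_pos[OF rJ] p_pos[of v] elim by simp
      then have 2: "r * p r + v * p v = ?M * (p r + p v)" by (simp add: barycenter_def)
      show ?thesis unfolding f_def h_def using 1 2 by algebra
    qed
    have r1: "(a * m s v + b) * h = (c * m s v + d) * f" using rel[of s] s elim by simp
    have r2: "(a * m t v + b) * h = (c * m t v + d) * f" using rel[of t] t elim by simp
    have "(a * d - b * c) * (m s v - m t v) * h = 0" using r1 r2 by algebra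
    moreover have "(a * d - b * c) * (m s v - m t v) * f = 0" using r1 r2 by algebra
    ultimately have "h = 0" "f = 0" using det elim by auto
    then show ?case using elim by (simp add: agreement_def f_def h_def)
  qed
qed

text \<open>The component of the agreement set that contains the given interval is closed in \<open>J\<close> by continuity and
  open by the preceding lemma, so it is all of the connected set \<open>J\<close>.\<close>

lemma agreement_global:
  assumes xy: "x < y" "{x..y} \<subseteq> agreement a b c d"
  shows "agreement a b c d = J"
proof -
  let ?S = "agreement a b c d"
  let ?K = "connected_component_set ?S x"
  have sub: "?S \<subseteq> J" by (auto simp: agreement_def)
  have "closedin (top_of_set J) ({z \<in> J. \<phi> z - p z * (a * z + b) = 0} \<inter> {z \<in> J. \<psi> z - p z * (c * z + d) = 0})"
    by (intro closedin_Int continuous_closedin_preimage_constant continuous_intros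
        continuous_at_imp_continuous_on ballI cont_at)
  moreover have "({z \<in> J. \<phi> z - p z * (a * z + b) = 0} \<inter> {z \<in> J. \<psi> z - p z * (c * z + d) = 0}) = ?S"
    by (auto simp: agreement_def)
  ultimately have "closedin (top_of_set J) ?S" by simp
  then have cl: "closedin (top_of_set J) ?K"
    using closedin_connected_component[of ?S x] by (rule closedin_trans[rotated])
  have K: "{x..y} \<subseteq> ?K" "?K \<subseteq> ?S" "connected ?K"
    using connected_component_maximal[of x "{x..y}" ?S] xy
    by (auto simp: connected_component_subset)
  have "open ?K"
  proof (subst open_subopen, intro ballI)
    fix e assume e: "e \<in> ?K"
    have "{min x e..max y e} \<subseteq> ?K"
    proof (rule connected_contains_Icc[OF K(3)])
      have "x \<in> ?K" "y \<in> ?K" by (rule subsetD[OF K(1)], simp add: xy(1) less_imp_le)+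
      then show "min x e \<in> ?K" "max y e \<in> ?K" using e unfolding min_def max_def by presburger+
    qed
    then have "\<forall>\<^sub>F v in nhds e. v \<in> ?S"
      using agreement_step[of "min x e" "max y e" a b c d e] xy K by auto
    then obtain r where r: "0 < r" "ball e r \<subseteq> ?S"
      by (auto simp: eventually_nhds_metric subset_iff dist_commute)
    have "e \<in> ?S" using e K by auto
    have "ball e r \<subseteq> connected_component_set ?S e"
      using r by (intro connected_component_maximal) auto
    also have "\<dots> = ?K" using e connected_component_eq by metis
    finally show "\<exists>T. open T \<and> e \<in> T \<and> T \<subseteq> ?K" using r by (intro exI[of _ "ball e r"]) auto
  qed
  then have "openin (top_of_set J) ?K" using K sub open_J by (auto simp: openin_open_eq)
  moreover have "connected J" using interval_J is_interval_connected by blast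
  ultimately have "?K = {} \<or> ?K = J" using cl unfolding connected_clopen by blast
  moreover have "x \<in> ?K" by (rule subsetD[OF K(1)]) (simp add: xy(1) less_imp_le)
  ultimately have "?K = J" by blast
  then show ?thesis using K(2) sub by blast
qed

end

text \<open>The relation \<open>W = \<gamma> p\<^sup>2\<close> is separated from the functional equation, because in the converse direction it is
  a hypothesis and the functional equation is the conclusion.\<close>

locale proportional_pair = mean_pair +
  fixes \<gamma> :: real
  assumes wronskian_eq: "\<And>u. u \<in> J \<Longrightarrow> wronskian \<phi> \<psi> u = \<gamma> * (p u)\<^sup>2"
begin

lemma \<gamma>_nz: "u \<in> J \<Longrightarrow> \<gamma> \<noteq> 0"
  using wronskian_eq[of u] wronskian_nz[of u] by auto

lemma D\<phi>_eq: "u \<in> J \<Longrightarrow> deriv \<phi> u = (\<gamma> * (p u)\<^sup>2 + deriv \<psi> u * \<phi> u) / \<psi> u"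
  using wronskian_eq[of u] \<psi>_pos[of u] by (simp add: wronskian_def field_simps)

end

locale normalized_mean_equation = mean_equation + proportional_pair
begin

text \<open>The relation says that near \<open>u\<close>, \<open>\<phi> / \<psi>\<close> is the Moebius transformation
  \<open>x \<mapsto> \<phi>(u) / \<psi>(u) + (g / \<psi>(u)) (u - x) / l(x)\<close> with \<open>l(x) = 1 + k (u - x)\<close>. Its derivative is a multiple
  of \<open>1 / l\<^sup>2\<close>, and it is also \<open>W / \<psi>\<^sup>2 = \<gamma> p\<^sup>2 / \<psi>\<^sup>2\<close>. So \<open>\<psi>\<close> is a multiple of \<open>p l\<close>, and \<open>\<phi>\<close> is \<open>p\<close> times
  another affine function.\<close>

lemma local_agreement:
  assumes u: "u \<in> J" and e: "0 < e"
    and rel: "\<And>x. \<bar>x - u\<bar> < e \<Longrightarrow> x \<in> J \<and>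
      (1 + k * (u - x)) * (\<phi> x * \<psi> u - \<phi> u * \<psi> x) = g * \<psi> x * (u - x)"
  shows "\<exists>a b c d. a * d - b * c \<noteq> 0 \<and> agreement a b c d = J"
proof -
  let ?l = "\<lambda>x. 1 + k * (u - x)"
  have pos: "0 < p u" "0 < \<psi> u" using p_pos \<psi>_pos u by auto
  have "isCont ?l u" by (intro continuous_intros)
  then have "(?l \<longlongrightarrow> 1) (nhds u)" using isCont_tendsto_nhds[where f = ?l and x = u] by simp
  then have "\<forall>\<^sub>F x in nhds u. 0 < ?l x" by (rule order_tendstoD) simp
  then obtain e' where e': "0 < e'" "\<And>x. \<bar>x - u\<bar> < e' \<Longrightarrow> 0 < ?l x"
    by (auto simp: eventually_nhds_metric dist_real_def)
  define r where "r = min e e'"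
  have r: "0 < r" "\<And>x. \<bar>x - u\<bar> < r \<Longrightarrow> x \<in> J" "\<And>x. \<bar>x - u\<bar> < r \<Longrightarrow> 0 < ?l x"
    using e e' rel by (auto simp: r_def)
  have F: "\<phi> x / \<psi> x = \<phi> u / \<psi> u + g / \<psi> u * ((u - x) / ?l x)" if x: "\<bar>x - u\<bar> < r" for x
  proof -
    have "0 < \<psi> x" "0 < ?l x" using r x \<psi>_pos by auto
    moreover have "?l x * (\<phi> x * \<psi> u - \<phi> u * \<psi> x) = g * \<psi> x * (u - x)"
      using rel[of x] x by (simp add: r_def)
    ultimately have "\<phi> x * \<psi> u - \<phi> u * \<psi> x = g * \<psi> x * (u - x) / ?l x"
      by (simp add: eq_divide_eq mult.commute)
    then have "\<phi> x = (\<phi> u * \<psi> x + g * \<psi> x * (u - x) / ?l x) / \<psi> u"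
      by (subst eq_divide_eq) (use pos in \<open>simp add: algebra_simps\<close>)
    then show ?thesis using pos \<open>0 < \<psi> x\<close> by (simp add: add_divide_distrib)
  qed
  have D: "\<gamma> * (p x)\<^sup>2 / (\<psi> x)\<^sup>2 = - (g / \<psi> u) / (?l x)\<^sup>2" if x: "\<bar>x - u\<bar> < r" for x
  proof -
    have l: "?l x \<noteq> 0" using r(3)[OF x] by simp
    have "((\<lambda>x. (u - x) / ?l x) has_real_derivative (- 1 * ?l x - (u - x) * (- k)) / (?l x * ?l x)) (at x)"
      using l by (intro DERIV_divide) (auto intro!: derivative_eq_intros)
    moreover have "- 1 * ?l x - (u - x) * (- k) = - 1" by (simp add: algebra_simps)
    ultimately have "((\<lambda>x. (u - x) / ?l x) has_real_derivative - 1 / (?l x)\<^sup>2) (at x)"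
      by (simp add: power2_eq_square)
    then have "((\<lambda>x. \<phi> u / \<psi> u + g / \<psi> u * ((u - x) / ?l x)) has_real_derivative
        0 + g / \<psi> u * (- 1 / (?l x)\<^sup>2)) (at x)"
      by (intro DERIV_add DERIV_const DERIV_cmult)
    then have "((\<lambda>x. \<phi> u / \<psi> u + g / \<psi> u * ((u - x) / ?l x)) has_real_derivative
        - (g / \<psi> u) / (?l x)\<^sup>2) (at x)" by simp
    then have "((\<lambda>x. \<phi> x / \<psi> x) has_real_derivative - (g / \<psi> u) / (?l x)\<^sup>2) (at x)"
    proof (rule has_field_derivative_transform_within_open)
      show "open {u - r<..<u + r}" "x \<in> {u - r<..<u + r}" using x by auto
      show "\<phi> u / \<psi> u + g / \<psi> u * ((u - y) / ?l y) = \<phi> y / \<psi> y" if "y \<in> {u - r<..<u + r}" for y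
        using F[of y] that by auto
    qed
    from DERIV_unique[OF D_ratio[OF r(2)[OF x]] this] show ?thesis
      by (simp add: wronskian_eq r(2)[OF x])
  qed
  have \<psi>: "\<psi> x = p x * (\<psi> u / p u * ?l x)" if x: "\<bar>x - u\<bar> < r" for x
  proof -
    have px: "0 < p x" "0 < \<psi> x" "0 < ?l x" using r x \<psi>_pos p_pos by auto
    have "- (g / \<psi> u) = \<gamma> * (p u)\<^sup>2 / (\<psi> u)\<^sup>2" using D[of u] r(1) by simp
    then have "\<gamma> * ((p x)\<^sup>2 / (\<psi> x)\<^sup>2) = \<gamma> * ((p u)\<^sup>2 / (\<psi> u)\<^sup>2 / (?l x)\<^sup>2)"
      using D[OF x] by simp
    then have "(p x)\<^sup>2 / (\<psi> x)\<^sup>2 = (p u)\<^sup>2 / (\<psi> u)\<^sup>2 / (?l x)\<^sup>2"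
      using \<gamma>_nz[OF u] mult_left_cancel by blast
    then have "(p x / \<psi> x)\<^sup>2 = (p u / \<psi> u / ?l x)\<^sup>2" by (simp only: power_divide)
    then have "p x / \<psi> x = p u / \<psi> u / ?l x" using px pos by (simp add: power2_eq_iff_nonneg)
    moreover have "y = z * (s / q * l)" if "0 < y" "0 < s" "0 < l" "0 < q" "z / y = q / s / l" for y z s q l :: real
      using that by (simp add: field_simps)
    ultimately show ?thesis using px pos by blast
  qed
  \<comment> \<open>The coefficients of \<open>\<psi>(u) l(x) / p(u)\<close> and of \<open>(\<phi>(u) l(x) + g (u - x)) / p(u)\<close> as affine functions
    of \<open>x\<close>.\<close>
  define c where "c = - k * \<psi> u / p u"
  define d where "d = (1 + k * u) * \<psi> u / p u"
  define a where "a = - (k * \<phi> u + g) / p u"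
  define b where "b = ((1 + k * u) * \<phi> u + g * u) / p u"
  have agr: "x \<in> agreement a b c d" if x: "\<bar>x - u\<bar> < r" for x
  proof -
    have px: "0 < p x" "0 < \<psi> x" "0 < ?l x" using r x \<psi>_pos p_pos by auto
    have "\<phi> x = \<psi> x * (\<phi> u / \<psi> u + g / \<psi> u * ((u - x) / ?l x))"
      using F[OF x] px by (simp add: field_simps)
    also have "\<dots> = (p x * (\<psi> u / p u * ?l x)) * (\<phi> u / \<psi> u + g / \<psi> u * ((u - x) / ?l x))"
      using \<psi>[OF x] by simp
    also have "\<dots> = p x * ((\<phi> u * ?l x + g * (u - x)) / p u)"
    proof -
      have alg: "(q * (s / w * l)) * (f / s + g / s * (z / l)) = q * ((f * l + g * z) / w)"
        if "s \<noteq> 0" "w \<noteq> 0" "l \<noteq> 0" for q s w l f z :: real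
        using that by (simp add: field_simps)
      show ?thesis by (rule alg) (use px pos in auto)
    qed
    also have "(\<phi> u * ?l x + g * (u - x)) / p u = a * x + b"
      using pos by (simp add: a_def b_def field_simps)
    finally have "\<phi> x = p x * (a * x + b)" .
    moreover have "\<psi> u / p u * ?l x = c * x + d" using pos by (simp add: c_def d_def field_simps)
    ultimately show ?thesis using \<psi>[OF x] r(2)[OF x] by (simp add: agreement_def)
  qed
  have "{u - r/2..u + r/2} \<subseteq> agreement a b c d"
  proof
    fix x assume "x \<in> {u - r/2..u + r/2}"
    then have "u - r/2 \<le> x" "x \<le> u + r/2" by auto
    then have "\<bar>x - u\<bar> \<le> r/2" by linarith
    then show "x \<in> agreement a b c d" using agr r(1) by simp
  qed
  moreover have "u - r/2 < u + r/2" using r(1) by simp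
  ultimately have "agreement a b c d = J" by (rule agreement_global[rotated])
  moreover have "a * d - b * c \<noteq> 0"
    using agreement_det[of u a b c d "u + r/2"] agr[of u] agr[of "u + r/2"] r(1) by simp
  ultimately show ?thesis by blast
qed

section \<open>Smoothness outside the degenerate case\<close>

text \<open>Coefficients and right-hand side of the linear relation between \<open>p'(u)\<close> and \<open>\<psi>'(u)\<close> that remains of the
  first-order equation when \<open>\<phi>'(u)\<close> is eliminated by \<open>W = \<gamma> p\<^sup>2\<close>. The point \<open>v\<close> is a parameter; no
  derivative occurs in the three expressions.\<close>

definition coeff_p :: "real \<Rightarrow> real \<Rightarrow> real" where
  "coeff_p v u = \<gamma> * (p (m u v))\<^sup>2 * (u - m u v) * (\<psi> u + \<psi> v) * \<psi> u"
definition coeff_\<psi> :: "real \<Rightarrow> real \<Rightarrow> real" where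
  "coeff_\<psi> v u = (\<phi> (m u v) * \<psi> u - \<phi> u * \<psi> (m u v)) * \<psi> (m u v) * (p u + p v)"
definition sys_rhs :: "real \<Rightarrow> real \<Rightarrow> real" where
  "sys_rhs v u = \<gamma> * (p u)\<^sup>2 * (\<psi> (m u v))\<^sup>2 * (p u + p v) - \<gamma> * (p (m u v))\<^sup>2 * p u * (\<psi> u + \<psi> v) * \<psi> u"

lemma linear_relation:
  assumes u: "u \<in> J" and v: "v \<in> J"
  shows "coeff_p v u * deriv p u + coeff_\<psi> v u * deriv \<psi> u = sys_rhs v u"
proof -
  let ?M = "m u v"
  have 1: "\<gamma> * (p ?M)\<^sup>2 * (p u + (u - ?M) * deriv p u) * (\<psi> u + \<psi> v) =
    (deriv \<phi> u * \<psi> ?M - deriv \<psi> u * \<phi> ?M) * \<psi> ?M * (p u + p v)"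
    using first_order_equation[OF u v] wronskian_eq[OF mem[OF u v]] by simp
  have 2: "deriv \<phi> u * \<psi> u = \<gamma> * (p u)\<^sup>2 + deriv \<psi> u * \<phi> u"
    using wronskian_eq[OF u] by (simp add: wronskian_def algebra_simps)
  show ?thesis unfolding coeff_p_def coeff_\<psi>_def sys_rhs_def using 1 2 by algebra
qed

definition sys_det :: "real \<Rightarrow> real \<Rightarrow> real \<Rightarrow> real" where
  "sys_det v w u = coeff_p v u * coeff_\<psi> w u - coeff_p w u * coeff_\<psi> v u"

text \<open>If all the linear relations at \<open>u\<close> are multiples of each other, then \<open>coeff_p = c coeff_\<psi>\<close> with a
  constant \<open>c\<close>, so \<open>sys_rhs = k coeff_\<psi>\<close> with \<open>k = c p'(u) + \<psi>'(u)\<close>. After cancelling, \<open>v\<close> enters this only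
  through \<open>m(u, v)\<close>, which covers a neighbourhood of \<open>u\<close>; what is left is the relation assumed in
  \<open>local_agreement\<close>.\<close>

lemma degenerate_agreement:
  assumes u: "u \<in> J" and det: "\<And>v w. v \<in> J \<Longrightarrow> w \<in> J \<Longrightarrow> sys_det v w u = 0"
  shows "\<exists>a b c d. a * d - b * c \<noteq> 0 \<and> agreement a b c d = J"
proof -
  from open_J u obtain h where h: "0 < h" "cball u h \<subseteq> J" by (meson open_contains_cball)
  have hJ: "v \<in> J" if "u - h \<le> v" "v \<le> u + h" for v
    using that h by (auto simp: subset_iff dist_real_def abs_le_iff)
  define w where "w = u + h"
  have w: "w \<in> J" "w \<noteq> u" using hJ[of w] h by (auto simp: w_def)
  have pos: "0 < p u" "0 < \<psi> u" using p_pos \<psi>_pos u by auto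
  have M: "m u w \<noteq> u" "m u w \<in> J" using barycenter_neq[of p u w] p_pos u w mem by auto
  have aw: "coeff_p w u \<noteq> 0"
    using M \<gamma>_nz[OF u] p_pos[OF M(2)] \<psi>_pos[OF w(1)] pos by (auto simp: coeff_p_def)
  have bw: "coeff_\<psi> w u \<noteq> 0"
    using cross_nz[OF M(2) u M(1)] \<psi>_pos[OF M(2)] pos p_pos[OF w(1)] by (auto simp: coeff_\<psi>_def)
  define c where "c = coeff_p w u / coeff_\<psi> w u"
  have c: "c \<noteq> 0" using aw bw by (simp add: c_def)
  define k where "k = c * deriv p u + deriv \<psi> u"
  have star: "(k * (u - m u v) + p u * c) * (\<phi> (m u v) * \<psi> u - \<phi> u * \<psi> (m u v)) =
      \<gamma> * (p u)\<^sup>2 * \<psi> (m u v) * (u - m u v)" if v: "v \<in> J" for v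
  proof -
    let ?M = "m u v"
    have "coeff_p v u = c * coeff_\<psi> v u"
      using det[OF v w(1)] bw unfolding sys_det_def c_def by (simp add: field_simps)
    then have 1: "coeff_\<psi> v u * k = sys_rhs v u" "coeff_p v u = c * coeff_\<psi> v u"
      using linear_relation[OF u v] by (simp_all add: k_def algebra_simps)
    have "(u - ?M) * sys_rhs v u = \<gamma> * (p u)\<^sup>2 * (\<psi> ?M)\<^sup>2 * (p u + p v) * (u - ?M) - p u * coeff_p v u"
      unfolding sys_rhs_def coeff_p_def by algebra
    then have "(k * (u - ?M) + p u * c) * coeff_\<psi> v u = \<gamma> * (p u)\<^sup>2 * (\<psi> ?M)\<^sup>2 * (p u + p v) * (u - ?M)"
      unfolding 1(1)[symmetric] 1(2) by algebra
    then have "((k * (u - ?M) + p u * c) * (\<phi> ?M * \<psi> u - \<phi> u * \<psi> ?M)) * (\<psi> ?M * (p u + p v)) =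
        (\<gamma> * (p u)\<^sup>2 * \<psi> ?M * (u - ?M)) * (\<psi> ?M * (p u + p v))"
      unfolding coeff_\<psi>_def by algebra
    moreover have "\<psi> ?M * (p u + p v) \<noteq> 0"
      using \<psi>_pos[OF mem[OF u v]] pos p_pos[OF v] by simp
    ultimately show ?thesis using mult_right_cancel by blast
  qed
  \<comment> \<open>By the intermediate value theorem \<open>m(u, v)\<close> attains all values within distance \<open>e\<close> of \<open>u\<close>.\<close>
  define e where "e = min (u - m u (u - h)) (m u (u + h) - u)"
  have "m u (u - h) < u" "u < m u (u + h)"
    using barycenter_between[of p "u - h" u] barycenter_between[of p u "u + h"] barycenter_commute[of p u "u - h"]
      p_pos[OF hJ] h pos by auto
  then have e: "0 < e" by (simp add: e_def)
  have surj: "\<exists>v\<in>J. m u v = x" if x: "\<bar>x - u\<bar> < e" for x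
  proof -
    have "\<exists>v\<ge>u - h. v \<le> u + h \<and> m u v = x"
    proof (rule IVT)
      show "m u (u - h) \<le> x" "x \<le> m u (u + h)" using x by (auto simp: e_def abs_less_iff)
      show "u - h \<le> u + h" using h by simp
      show "\<forall>v. u - h \<le> v \<and> v \<le> u + h \<longrightarrow> isCont (m u) v"
        using m_cont'[OF u hJ] by blast
    qed
    then show ?thesis using hJ by blast
  qed
  show ?thesis
  proof (rule local_agreement[OF u e, of "k / (p u * c)" "\<gamma> * p u / c"])
    fix x assume "\<bar>x - u\<bar> < e"
    then obtain v where v: "v \<in> J" "m u v = x" using surj by blast
    have "(k * (u - x) + p u * c) * (\<phi> x * \<psi> u - \<phi> u * \<psi> x) = \<gamma> * (p u)\<^sup>2 * \<psi> x * (u - x)"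
      using star[OF v(1)] v(2) by simp
    then have "(k * (u - x) + p u * c) * (\<phi> x * \<psi> u - \<phi> u * \<psi> x) / (p u * c) = \<gamma> * (p u)\<^sup>2 * \<psi> x * (u - x) / (p u * c)"
      by simp
    moreover have "(k * (u - x) + p u * c) / (p u * c) = 1 + k / (p u * c) * (u - x)"
      using pos c by (simp add: field_simps)
    moreover have "\<gamma> * (p u)\<^sup>2 * \<psi> x * (u - x) / (p u * c) = \<gamma> * p u / c * \<psi> x * (u - x)"
      using pos c by (simp add: power2_eq_square)
    ultimately show "x \<in> J \<and> (1 + k / (p u * c) * (u - x)) * (\<phi> x * \<psi> u - \<phi> u * \<psi> x) = \<gamma> * p u / c * \<psi> x * (u - x)"
      using mem[OF u v(1)] v(2) by (metis times_divide_eq_left)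
  qed
qed

text \<open>Near each point Cramer's rule expresses \<open>p'\<close> and \<open>\<psi>'\<close>, and \<open>W = \<gamma> p\<^sup>2\<close> expresses \<open>\<phi>'\<close>, by arithmetic
  operations and compositions of \<open>p\<close>, \<open>\<phi>\<close>, \<open>\<psi>\<close> and \<open>m\<close>. So the derivatives are differentiable as often as
  the functions, and each round gains one order.\<close>

lemma bootstrap:
  assumes nondeg: "\<And>u. u \<in> J \<Longrightarrow> \<exists>v\<in>J. \<exists>w\<in>J. sys_det v w u \<noteq> 0"
  shows "ndiff n p J \<and> ndiff n \<phi> J \<and> ndiff n \<psi> J"
proof (induction n)
  case (Suc n)
  then have np: "ndiff n p J" and n\<phi>: "ndiff n \<phi> J" and n\<psi>: "ndiff n \<psi> J" by auto
  have nm: "ndiff n (\<lambda>u. m u v) J" if v: "v \<in> J" for v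
    unfolding barycenter_def using p_pos v
    by (intro ndiff_divide ndiff_add ndiff_mult ndiff_const ndiff_ident open_J np) (simp add: add_pos_pos less_imp_neq[THEN not_sym])
  have comp: "ndiff n (\<lambda>u. f (m u v)) J" if "v \<in> J" "ndiff n f J" for v f
    by (rule ndiff_compose[OF open_J that(2) nm[OF that(1)]]) (simp add: mem that)
  note nintros = ndiff_add ndiff_diff ndiff_mult ndiff_power ndiff_const ndiff_ident open_J
    np n\<phi> n\<psi> nm comp
  have na: "ndiff n (coeff_p v) J" and nb: "ndiff n (coeff_\<psi> v) J" and nr: "ndiff n (sys_rhs v) J" if "v \<in> J" for v
    unfolding coeff_p_def[abs_def] coeff_\<psi>_def[abs_def] sys_rhs_def[abs_def] by (intro nintros that)+
  have local: "\<exists>U. open U \<and> u \<in> U \<and> U \<subseteq> J \<and> ndiff n (deriv p) U \<and> ndiff n (deriv \<psi>) U" if u: "u \<in> J" for u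
  proof -
    obtain v w where vw: "v \<in> J" "w \<in> J" "sys_det v w u \<noteq> 0" using nondeg[OF u] by blast
    have cc: "isCont (\<lambda>u. f (m u v)) x" if "x \<in> J" "v \<in> J" "\<And>y. y \<in> J \<Longrightarrow> isCont f y" for f v x
      by (rule isCont_o2[OF m_cont]) (use that mem in auto)
    have "continuous_on J (sys_det v w)"
      unfolding sys_det_def[abs_def] coeff_p_def coeff_\<psi>_def
      by (intro continuous_at_imp_continuous_on ballI continuous_intros cc cont_at m_cont vw)
    define U where "U = {x \<in> J. sys_det v w x \<noteq> 0}"
    have "open (J \<inter> sys_det v w -` (- {0}))"
      by (rule continuous_open_preimage[OF \<open>continuous_on J (sys_det v w)\<close> open_J]) auto
    moreover have "J \<inter> sys_det v w -` (- {0}) = U" by (auto simp: U_def)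
    ultimately have U: "open U" "U \<subseteq> J" "u \<in> U" using vw u by (auto simp: U_def)
    have nU: "ndiff n f U" if "ndiff n f J" for f using ndiff_subset[OF that U(2)] .
    have solve: "deriv p x = (sys_rhs v x * coeff_\<psi> w x - sys_rhs w x * coeff_\<psi> v x) / sys_det v w x"
         "deriv \<psi> x = (coeff_p v x * sys_rhs w x - coeff_p w x * sys_rhs v x) / sys_det v w x" if "x \<in> U" for x
    proof -
      have x: "x \<in> J" "sys_det v w x \<noteq> 0" using that by (auto simp: U_def)
      have "deriv p x * sys_det v w x = sys_rhs v x * coeff_\<psi> w x - sys_rhs w x * coeff_\<psi> v x"
        "deriv \<psi> x * sys_det v w x = coeff_p v x * sys_rhs w x - coeff_p w x * sys_rhs v x"
        unfolding sys_det_def linear_relation[OF x(1) vw(1), symmetric] linear_relation[OF x(1) vw(2), symmetric]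
        by algebra+
      then show "deriv p x = (sys_rhs v x * coeff_\<psi> w x - sys_rhs w x * coeff_\<psi> v x) / sys_det v w x"
         "deriv \<psi> x = (coeff_p v x * sys_rhs w x - coeff_p w x * sys_rhs v x) / sys_det v w x"
        using x by (simp_all add: eq_divide_eq)
    qed
    have nUabr: "ndiff n (coeff_p z) U" "ndiff n (coeff_\<psi> z) U" "ndiff n (sys_rhs z) U" if "z \<in> J" for z
      using nU na nb nr that by blast+
    have det: "ndiff n (sys_det v w) U"
      unfolding sys_det_def[abs_def] by (intro ndiff_diff ndiff_mult nUabr U(1) vw(1,2))
    have "ndiff n (deriv p) U"
      by (rule ndiff_cong[OF U(1) solve(1)[symmetric]])
         (assumption, intro ndiff_divide ndiff_diff ndiff_mult nUabr det U(1) vw(1,2), simp add: U_def)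
    moreover have "ndiff n (deriv \<psi>) U"
      by (rule ndiff_cong[OF U(1) solve(2)[symmetric]])
         (assumption, intro ndiff_divide ndiff_diff ndiff_mult nUabr det U(1) vw(1,2), simp add: U_def)
    ultimately show ?thesis using U by blast
  qed
  have "ndiff n (deriv p) J" by (rule ndiff_local) (use local in blast)
  moreover have d\<psi>: "ndiff n (deriv \<psi>) J" by (rule ndiff_local) (use local in blast)
  moreover have "ndiff n (deriv \<phi>) J"
  proof (rule ndiff_cong[OF open_J D\<phi>_eq[symmetric]])
    show "ndiff n (\<lambda>u. (\<gamma> * (p u)\<^sup>2 + deriv \<psi> u * \<phi> u) / \<psi> u) J"
      using \<psi>_pos by (intro ndiff_divide nintros d\<psi>) force
  qed
  ultimately show ?case using Dp D\<phi> D\<psi> by (auto simp: field_differentiable_def)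
qed auto

lemma agreement_or_smooth:
  "(\<exists>a b c d. a * d - b * c \<noteq> 0 \<and> agreement a b c d = J) \<or>
   (\<forall>n. ndiff n p J \<and> ndiff n \<phi> J \<and> ndiff n \<psi> J)"
  using degenerate_agreement bootstrap by blast

end

section \<open>The two equations of second order\<close>

locale smooth_pair = proportional_pair +
  assumes smooth_p: "\<And>n. ndiff n p J" and smooth_\<phi>: "\<And>n. ndiff n \<phi> J" and smooth_\<psi>: "\<And>n. ndiff n \<psi> J"
begin

abbreviation "p1 \<equiv> deriv p"
abbreviation "p2 \<equiv> deriv (deriv p)"

lemma D2:
  assumes "u \<in> J"
  shows "(deriv p has_real_derivative deriv (deriv p) u) (at u)"
    "(deriv \<phi> has_real_derivative deriv (deriv \<phi>) u) (at u)"
    "(deriv \<psi> has_real_derivative deriv (deriv \<psi>) u) (at u)"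
  using smooth_p[of "Suc (Suc 0)"] smooth_\<phi>[of "Suc (Suc 0)"] smooth_\<psi>[of "Suc (Suc 0)"] assms
  by (auto simp: DERIV_deriv_iff_field_differentiable)

text \<open>With \<open>q(u) = u p(u)\<close> these are \<open>W\<^sub>q\<^sub>'\<^sub>,\<^sub>p\<^sub>' / W\<^sub>q\<^sub>,\<^sub>p\<^sup>3\<close> and, up to the factor \<open>\<gamma>\<^sup>2\<close>,
  \<open>W\<^sub>\<phi>\<^sub>'\<^sub>,\<^sub>\<psi>\<^sub>' / W\<^sub>\<phi>\<^sub>,\<^sub>\<psi>\<^sup>3\<close>. They are normalized such that \<open>y\<^sub>s\<^sub>s = - \<kappa> y\<close> and \<open>y\<^sub>s\<^sub>s = - \<mu> y\<close> hold for
  \<open>y = q, p\<close> and \<open>y = \<phi>, \<psi>\<close> with respect to one and the same parameter \<open>s\<close>, \<open>s' = p\<^sup>2\<close>.\<close>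

definition \<kappa> :: "real \<Rightarrow> real" where "\<kappa> u = (2 * (p1 u)\<^sup>2 - p u * p2 u) / (p u) ^ 6"
definition \<mu> :: "real \<Rightarrow> real" where "\<mu> u = wronskian (deriv \<phi>) (deriv \<psi>) u / (\<gamma> * (p u) ^ 6)"

lemma Dp_smooth: "u \<in> J \<Longrightarrow> (p has_real_derivative deriv p u) (at u)"
  using smooth_p[of "Suc 0"] by (auto simp: DERIV_deriv_iff_field_differentiable)

lemma p_ode:
  assumes "u \<in> J"
  shows "p u * p2 u = 2 * (p1 u)\<^sup>2 - \<kappa> u * (p u) ^ 6"
  using p_pos[OF assms] by (simp add: \<kappa>_def)

text \<open>Every solution \<open>y\<close> in the span of \<open>\<phi>\<close> and \<open>\<psi>\<close> satisfies \<open>W y'' - W' y' + W\<^sub>\<phi>\<^sub>'\<^sub>,\<^sub>\<psi>\<^sub>' y = 0\<close>, by expanding a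
  determinant with a repeated row. Here \<open>W = \<gamma> p\<^sup>2\<close>.\<close>

lemma \<phi>\<psi>_ode:
  assumes u: "u \<in> J"
  shows "p u * deriv (deriv \<phi>) u = 2 * p1 u * deriv \<phi> u - \<mu> u * (p u) ^ 5 * \<phi> u"
    and "p u * deriv (deriv \<psi>) u = 2 * p1 u * deriv \<psi> u - \<mu> u * (p u) ^ 5 * \<psi> u"
proof -
  have pos: "0 < p u" using p_pos u by auto
  have "(W has_real_derivative deriv (deriv \<phi>) u * \<psi> u - \<phi> u * deriv (deriv \<psi>) u) (at u)"
    unfolding wronskian_def[abs_def]
    by (auto intro!: derivative_eq_intros D2 D\<phi> D\<psi> u simp: algebra_simps)
  moreover have "(W has_real_derivative 2 * \<gamma> * p u * p1 u) (at u)"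
  proof (rule has_field_derivative_transform_within_open[OF _ open_J u wronskian_eq[symmetric]])
    show "((\<lambda>x. \<gamma> * (p x)\<^sup>2) has_real_derivative 2 * \<gamma> * p u * p1 u) (at u)"
      by (auto intro!: derivative_eq_intros Dp_smooth u)
  qed
  ultimately have 1: "deriv (deriv \<phi>) u * \<psi> u - \<phi> u * deriv (deriv \<psi>) u = 2 * \<gamma> * p u * p1 u"
    by (rule DERIV_unique)
  have 2: "deriv (deriv \<phi>) u * deriv \<psi> u - deriv \<phi> u * deriv (deriv \<psi>) u = \<mu> u * (\<gamma> * (p u) ^ 6)"
    using pos \<gamma>_nz[OF u] by (simp add: \<mu>_def wronskian_def)
  have 3: "deriv \<phi> u * \<psi> u - \<phi> u * deriv \<psi> u = \<gamma> * (p u)\<^sup>2"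
    using wronskian_eq[OF u] by (simp add: wronskian_def)
  have "(\<gamma> * p u) * (p u * deriv (deriv \<phi>) u) = (\<gamma> * p u) * (2 * p1 u * deriv \<phi> u - \<mu> u * (p u) ^ 5 * \<phi> u)"
    using 1 2 3 by algebra
  then show "p u * deriv (deriv \<phi>) u = 2 * p1 u * deriv \<phi> u - \<mu> u * (p u) ^ 5 * \<phi> u"
    using pos \<gamma>_nz[OF u] by simp
  have "(\<gamma> * p u) * (p u * deriv (deriv \<psi>) u) = (\<gamma> * p u) * (2 * p1 u * deriv \<psi> u - \<mu> u * (p u) ^ 5 * \<psi> u)"
    using 1 2 3 by algebra
  then show "p u * deriv (deriv \<psi>) u = 2 * p1 u * deriv \<psi> u - \<mu> u * (p u) ^ 5 * \<psi> u"
    using pos \<gamma>_nz[OF u] by simp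
qed

text \<open>Passage to the parameter \<open>s\<close>: the derivative of \<open>f\<close> with respect to \<open>s\<close> is \<open>f' / p\<^sup>2\<close>.\<close>

lemma sturm_liouville_form:
  assumes u: "u \<in> J"
    and df: "(f has_real_derivative h u) (at u)" and dh: "(h has_real_derivative h1) (at u)"
    and ode: "p u * h1 = 2 * p1 u * h u - c * (p u) ^ 5 * f u"
  shows "((\<lambda>x. h x / (p x)\<^sup>2) has_real_derivative - c * (p u)\<^sup>2 * f u) (at u)"
proof -
  have pos: "0 < p u" using p_pos u by auto
  have "((\<lambda>x. h x / (p x)\<^sup>2) has_real_derivative
      (h1 * (p u)\<^sup>2 - h u * (2 * p u * p1 u)) / ((p u)\<^sup>2 * (p u)\<^sup>2)) (at u)"
    using pos by (intro DERIV_divide dh) (auto intro!: derivative_eq_intros Dp_smooth u)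
  moreover have "(h1 * (p u)\<^sup>2 - h u * (2 * p u * p1 u)) / ((p u)\<^sup>2 * (p u)\<^sup>2) = - c * (p u)\<^sup>2 * f u"
  proof -
    have "h1 * (p u)\<^sup>2 - h u * (2 * p u * p1 u) = (- c * (p u)\<^sup>2 * f u) * ((p u)\<^sup>2 * (p u)\<^sup>2)"
      using ode by algebra
    then show ?thesis using pos by simp
  qed
  ultimately show ?thesis by simp
qed

lemma \<kappa>\<mu>_deriv:
  assumes u: "u \<in> J"
  shows "(\<kappa> has_real_derivative deriv \<kappa> u) (at u)" "(\<mu> has_real_derivative deriv \<mu> u) (at u)"
proof -
  let ?n = "Suc 0"
  have ndd: "ndiff n (deriv f) J" "ndiff n (deriv (deriv f)) J" if "\<And>n. ndiff n f J" for f n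
    using that[of "Suc n"] that[of "Suc (Suc n)"] by auto
  note sm = smooth_p smooth_\<phi> smooth_\<psi> ndd[OF smooth_p] ndd[OF smooth_\<phi>] ndd[OF smooth_\<psi>]
  have "ndiff ?n \<kappa> J"
    unfolding \<kappa>_def[abs_def]
    by (intro ndiff_divide ndiff_diff ndiff_mult ndiff_power ndiff_const open_J sm) (use p_pos in force)
  then show "(\<kappa> has_real_derivative deriv \<kappa> u) (at u)" by (rule ndiff_SucE[OF _ u])
  have "ndiff ?n \<mu> J"
    unfolding \<mu>_def[abs_def] wronskian_def
    by (intro ndiff_divide ndiff_diff ndiff_mult ndiff_power ndiff_const open_J sm) (use p_pos \<gamma>_nz in force)
  then show "(\<mu> has_real_derivative deriv \<mu> u) (at u)" by (rule ndiff_SucE[OF _ u])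
qed

text \<open>The solutions that vanish at \<open>x0\<close>, with their derivatives: \<open>moment\<close> belongs to the pair \<open>(q, p)\<close> and
  \<open>cross\<close> to \<open>(\<phi>, \<psi>)\<close>. The point \<open>x0\<close> is the barycenter of \<open>u\<close> and \<open>v\<close> if the moments cancel, and the
  functional equation with \<open>m(u, v) = x0\<close> says that the cross terms cancel.\<close>

definition moment :: "real \<Rightarrow> real \<Rightarrow> real" where "moment x0 u = p u * (u - x0)"
definition moment' :: "real \<Rightarrow> real \<Rightarrow> real" where "moment' x0 u = p u + (u - x0) * p1 u"
definition cross :: "real \<Rightarrow> real \<Rightarrow> real" where "cross x0 u = \<phi> u * \<psi> x0 - \<psi> u * \<phi> x0"
definition cross' :: "real \<Rightarrow> real \<Rightarrow> real" where
  "cross' x0 u = deriv \<phi> u * \<psi> x0 - deriv \<psi> u * \<phi> x0"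

lemma moment_at: "moment x0 x0 = 0" "moment' x0 x0 = p x0"
  by (simp_all add: moment_def moment'_def)

lemma cross_at: "cross x0 x0 = 0" "cross' x0 x0 = W x0"
  by (simp_all add: cross_def cross'_def wronskian_def)

lemma D_moment: "u \<in> J \<Longrightarrow> (moment x0 has_real_derivative moment' x0 u) (at u)"
  unfolding moment_def[abs_def] moment'_def
  by (auto intro!: derivative_eq_intros Dp_smooth simp: algebra_simps)

lemma D_moment': "u \<in> J \<Longrightarrow> (moment' x0 has_real_derivative 2 * p1 u + (u - x0) * p2 u) (at u)"
  unfolding moment'_def[abs_def]
  by (auto intro!: derivative_eq_intros Dp_smooth D2 simp: algebra_simps)

lemma D_cross: "u \<in> J \<Longrightarrow> (cross x0 has_real_derivative cross' x0 u) (at u)"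
  unfolding cross_def[abs_def] cross'_def by (auto intro!: derivative_eq_intros D\<phi> D\<psi>)

lemma D_cross': "u \<in> J \<Longrightarrow> (cross' x0 has_real_derivative
    deriv (deriv \<phi>) u * \<psi> x0 - deriv (deriv \<psi>) u * \<phi> x0) (at u)"
  unfolding cross'_def[abs_def] by (auto intro!: derivative_eq_intros D2)

lemma moment_ode:
  assumes u: "u \<in> J"
  shows "((\<lambda>x. moment' x0 x / (p x)\<^sup>2) has_real_derivative - \<kappa> u * (p u)\<^sup>2 * moment x0 u) (at u)"
  by (rule sturm_liouville_form[where f = "moment x0" and h = "moment' x0", OF u D_moment[OF u] D_moment'[OF u]])
     (use p_ode[OF u] in \<open>unfold moment_def moment'_def, algebra\<close>)

lemma cross_ode:
  assumes u: "u \<in> J"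
  shows "((\<lambda>x. cross' x0 x / (p x)\<^sup>2) has_real_derivative - \<mu> u * (p u)\<^sup>2 * cross x0 u) (at u)"
  by (rule sturm_liouville_form[where f = "cross x0" and h = "cross' x0", OF u D_cross[OF u] D_cross'[OF u]])
     (use \<phi>\<psi>_ode[OF u] in \<open>unfold cross_def cross'_def, algebra\<close>)

lemma m_of_moments:
  "u \<in> J \<Longrightarrow> v \<in> J \<Longrightarrow> moment x0 u + moment x0 v = 0 \<Longrightarrow> m u v = x0"
  using p_pos by (intro barycenter_unique) (auto simp: moment_def)

text \<open>Every solution of the equation of \<open>p\<close> and \<open>q\<close> lies in their span: \<open>(f / p)' p\<^sup>2\<close> is a Wronskian
  and so a multiple of \<open>p\<^sup>2\<close>, which makes \<open>f / p\<close> affine.\<close>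

lemma affine_multiple:
  assumes df: "\<And>u. u \<in> J \<Longrightarrow> (f has_real_derivative f1 u) (at u)"
    and df1: "\<And>u. u \<in> J \<Longrightarrow> (f1 has_real_derivative f2 u) (at u)"
    and ode: "\<And>u. u \<in> J \<Longrightarrow> p u * f2 u = 2 * p1 u * f1 u - \<kappa> u * (p u) ^ 5 * f u"
  shows "\<exists>a b. \<forall>u\<in>J. f u = p u * (a * u + b)"
proof -
  define t where "t = (\<lambda>u. (f1 u * p u - f u * p1 u) / (p u)\<^sup>2)"
  have dt: "((\<lambda>u. f u / p u) has_real_derivative t u) (at u)" if u: "u \<in> J" for u
    using p_pos[OF u] unfolding t_def
    by (auto intro!: derivative_eq_intros df Dp_smooth u simp: power2_eq_square)
  have "(t has_real_derivative 0) (at u)" if u: "u \<in> J" for u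
  proof -
    have pos: "0 < p u" using p_pos u by auto
    have "(t has_real_derivative ((f2 u * p u - f u * p2 u) * (p u)\<^sup>2 - (f1 u * p u - f u * p1 u) * (2 * p u * p1 u)) / ((p u)\<^sup>2 * (p u)\<^sup>2)) (at u)"
      unfolding t_def using pos
      by (intro DERIV_divide) (auto intro!: derivative_eq_intros df df1 Dp_smooth D2 u simp: algebra_simps)
    moreover have "(f2 u * p u - f u * p2 u) * (p u)\<^sup>2 - (f1 u * p u - f u * p1 u) * (2 * p u * p1 u) = 0"
      using ode[OF u] p_ode[OF u] by algebra
    ultimately show ?thesis by simp
  qed
  then obtain a where a: "\<And>u. u \<in> J \<Longrightarrow> t u = a" using constant_on_J by blast
  have "((\<lambda>u. f u / p u - a * u) has_real_derivative 0) (at u)" if u: "u \<in> J" for u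
    using DERIV_diff[OF dt[OF u] DERIV_cmult_Id[of a]] a[OF u] by simp
  then obtain b where b: "\<And>u. u \<in> J \<Longrightarrow> f u / p u - a * u = b"
    using constant_on_J[of "\<lambda>u. f u / p u - a * u"] by blast
  have "f u = p u * (a * u + b)" if u: "u \<in> J" for u
    using b[OF u] p_pos[OF u] by (simp add: field_simps)
  then show ?thesis by blast
qed

text \<open>The quasi-arithmetic mean \<open>x0\<close> generated by \<open>s\<close> solves both problems at once: moments and cross terms
  about \<open>x0\<close> are solutions of equations with constant coefficients, so they are odd in \<open>s - s(x0)\<close>.\<close>

lemma equation_of_constant_coefficients:
  assumes const: "\<And>x. x \<in> J \<Longrightarrow> \<kappa> x = \<alpha>" "\<And>x. x \<in> J \<Longrightarrow> \<mu> x = \<beta>"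
    and u: "u \<in> J" and v: "v \<in> J" and uv: "u \<le> v"
  shows "\<phi> (m u v) * (\<psi> u + \<psi> v) = \<psi> (m u v) * (\<phi> u + \<phi> v)"
proof -
  obtain e where e: "0 < e" "cball u e \<subseteq> J" using open_J u by (meson open_contains_cball)
  obtain e' where e': "0 < e'" "cball v e' \<subseteq> J" using open_J v by (meson open_contains_cball)
  \<comment> \<open>A larger interval, so that \<open>s\<close> has two-sided derivatives also at \<open>u\<close> and \<open>v\<close>.\<close>
  define a where "a = u - e"
  define b where "b = v + e'"
  have "a \<in> cball u e" "b \<in> cball v e'" using e(1) e'(1) by (auto simp: a_def b_def dist_real_def)
  then have "a \<in> J" "b \<in> J" using e(2) e'(2) by blast+
  then have sub: "{a..b} \<subseteq> J" using mem_is_interval_1_I[OF interval_J] by (meson atLeastAtMost_iff subsetI)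
  have ab: "a < u" "v < b" using e e' by (auto simp: a_def b_def)
  define s where "s = (\<lambda>x. integral {a..x} (\<lambda>x. (p x)\<^sup>2))"
  have ds: "(s has_real_derivative (p t)\<^sup>2) (at t)" if t: "t \<in> {u..v}" for t
  proof -
    have "continuous_on {a..b} (\<lambda>x. (p x)\<^sup>2)"
      by (intro continuous_intros continuous_on_subset[OF p_cont sub])
    moreover have "t \<in> {a..b}" using t ab by auto
    ultimately have "(s has_real_derivative (p t)\<^sup>2) (at t within {a..b})"
      unfolding s_def by (rule integral_has_real_derivative)
    then show ?thesis using t ab by (simp add: at_within_Icc_at)
  qed
  have tJ: "t \<in> J" if "t \<in> {u..v}" for t using that sub ab by (auto simp: subset_iff)
  have mono: "s u \<le> s v"
    using DERIV_nonneg_imp_nondecreasing[OF uv, of s] ds by (meson atLeastAtMost_iff zero_le_power2)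
  have "\<exists>t\<ge>u. t \<le> v \<and> s t = (s u + s v) / 2"
  proof (rule IVT)
    show "s u \<le> (s u + s v) / 2" "(s u + s v) / 2 \<le> s v" using mono by auto
    show "\<forall>x. u \<le> x \<and> x \<le> v \<longrightarrow> isCont s x" using ds DERIV_isCont by fastforce
  qed (rule uv)
  then obtain x0 where x0: "x0 \<in> {u..v}" "s u + s v = 2 * s x0" by auto
  have "moment x0 u + moment x0 v = 0"
  proof (rule solution_odd_about[where ?y1.0 = "\<lambda>x. moment' x0 x / (p x)\<^sup>2" and w = "\<lambda>x. (p x)\<^sup>2" and c = \<alpha>,
        OF _ _ ds _ x0(1) moment_at(1) uv x0(2)])
    fix t assume "t \<in> {u..v}"
    then have t: "t \<in> J" by (rule tJ)
    show "(moment x0 has_real_derivative (p t)\<^sup>2 * (moment' x0 t / (p t)\<^sup>2)) (at t)"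
      using D_moment[OF t] p_pos[OF t] by simp
    show "((\<lambda>x. moment' x0 x / (p x)\<^sup>2) has_real_derivative - \<alpha> * (p t)\<^sup>2 * moment x0 t) (at t)"
      using moment_ode[OF t] const(1)[OF t] by simp
  qed auto
  then have m: "m u v = x0" by (rule m_of_moments[OF u v])
  have "cross x0 u + cross x0 v = 0"
  proof (rule solution_odd_about[where ?y1.0 = "\<lambda>x. cross' x0 x / (p x)\<^sup>2" and w = "\<lambda>x. (p x)\<^sup>2" and c = \<beta>,
        OF _ _ ds _ x0(1) cross_at(1) uv x0(2)])
    fix t assume "t \<in> {u..v}"
    then have t: "t \<in> J" by (rule tJ)
    show "(cross x0 has_real_derivative (p t)\<^sup>2 * (cross' x0 t / (p t)\<^sup>2)) (at t)"
      using D_cross[OF t] p_pos[OF t] by simp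
    show "((\<lambda>x. cross' x0 x / (p x)\<^sup>2) has_real_derivative - \<beta> * (p t)\<^sup>2 * cross x0 t) (at t)"
      using cross_ode[OF t] const(2)[OF t] by simp
  qed auto
  then show ?thesis by (simp add: m cross_def algebra_simps)
qed

lemma times_ident_wronskians:
  assumes q: "\<And>u. u \<in> J \<Longrightarrow> q u = u * p u" and u: "u \<in> J"
  shows "wronskian q p u = (p u)\<^sup>2"
    and "wronskian (deriv q) (deriv p) u = 2 * (p1 u)\<^sup>2 - p u * p2 u"
proof -
  have dq: "deriv q x = p x + x * p1 x" if x: "x \<in> J" for x
  proof (rule DERIV_imp_deriv, rule has_field_derivative_transform_within_open[OF _ open_J x q[symmetric]])
    show "((\<lambda>x. x * p x) has_real_derivative p x + x * p1 x) (at x)"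
      by (auto intro!: derivative_eq_intros Dp_smooth x simp: algebra_simps)
  qed
  have ddq: "deriv (deriv q) u = 2 * p1 u + u * p2 u"
  proof (rule DERIV_imp_deriv, rule has_field_derivative_transform_within_open[OF _ open_J u dq[symmetric]])
    show "((\<lambda>x. p x + x * p1 x) has_real_derivative 2 * p1 u + u * p2 u) (at u)"
      by (auto intro!: derivative_eq_intros Dp_smooth D2 u simp: algebra_simps)
  qed
  show "wronskian q p u = (p u)\<^sup>2"
    by (simp add: wronskian_def dq[OF u] q[OF u] power2_eq_square algebra_simps)
  show "wronskian (deriv q) (deriv p) u = 2 * (p1 u)\<^sup>2 - p u * p2 u"
    by (simp add: wronskian_def dq[OF u] ddq power2_eq_square algebra_simps)
qed

lemma constant_coefficients_iff:
  assumes q: "\<And>u. u \<in> J \<Longrightarrow> q u = u * p u"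
  shows "(\<forall>u\<in>J. \<kappa> u = \<alpha> \<and> \<mu> u = \<beta> * \<gamma>\<^sup>2) \<longleftrightarrow>
    (\<forall>u\<in>J. wronskian (deriv q) (deriv p) u = \<alpha> * (wronskian q p u) ^ 3 \<and>
          wronskian (deriv \<phi>) (deriv \<psi>) u = \<beta> * (W u) ^ 3)"
proof (intro ball_cong conj_cong refl)
  fix u assume u: "u \<in> J"
  have pos: "p u \<noteq> 0" "\<gamma> \<noteq> 0" using p_pos[OF u] \<gamma>_nz[OF u] by auto
  have wr: "wronskian q p u = (p u)\<^sup>2"
    "wronskian (deriv q) (deriv p) u = 2 * (p1 u)\<^sup>2 - p u * p2 u"
    using times_ident_wronskians[OF q u] by auto
  have pw: "((p u)\<^sup>2) ^ 3 = (p u) ^ 6" "(\<gamma> * (p u)\<^sup>2) ^ 3 = \<gamma> * \<gamma>\<^sup>2 * (p u) ^ 6" by algebra+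
  show "\<kappa> u = \<alpha> \<longleftrightarrow> wronskian (deriv q) (deriv p) u = \<alpha> * (wronskian q p u) ^ 3"
    unfolding wr \<kappa>_def pw using pos by (simp add: divide_eq_eq)
  show "\<mu> u = \<beta> * \<gamma>\<^sup>2 \<longleftrightarrow> wronskian (deriv \<phi>) (deriv \<psi>) u = \<beta> * (W u) ^ 3"
    unfolding wronskian_eq[OF u] \<mu>_def pw using pos by (simp add: divide_eq_eq mult_ac)
qed

end

section \<open>Smooth solutions of the functional equation\<close>

locale smooth_mean_equation = normalized_mean_equation + smooth_pair
begin

text \<open>Near \<open>x0\<close> the function \<open>moment x0\<close> has an inverse \<open>g\<close>. The points \<open>g(y)\<close> and \<open>g(- y)\<close> have
  barycenter \<open>x0\<close>, so the functional equation says that \<open>cross x0 \<circ> g\<close> is odd, and the comparison of odd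
  solutions applies. The chain rule contributes \<open>g'(0) = 1 / p(x0)\<close> to the derivatives of both
  coefficients.\<close>

lemma comparison_at:
  assumes x0: "x0 \<in> J"
  shows "deriv \<mu> x0 = deriv \<kappa> x0"
    and "\<lbrakk>\<And>x. x \<in> J \<Longrightarrow> \<mu> x - \<kappa> x = d; d \<noteq> 0\<rbrakk> \<Longrightarrow> deriv \<kappa> x0 = 0"
proof -
  let ?X = "moment x0" and ?X' = "moment' x0" and ?Z = "cross x0" and ?Z' = "cross' x0"
  have pos: "0 < p x0" using p_pos x0 by auto
  note X0 = moment_at[of x0]
  obtain r g where r: "0 < r" and g0: "g 0 = x0" and
    g: "\<And>y. \<bar>y\<bar> < r \<Longrightarrow> g y \<in> J \<and> ?X (g y) = y \<and> 0 < ?X' x0 * ?X' (g y) \<and>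
            (g has_real_derivative inverse (?X' (g y))) (at y)"
  proof (rule real_local_inverse[OF open_J x0 D_moment])
    show "isCont ?X' x0" using D_moment'[OF x0] by (rule DERIV_isCont)
    show "?X' x0 \<noteq> 0" using pos X0 by simp
  next
    fix r g
    assume "0 < r" "g (?X x0) = x0" "\<And>y. \<bar>y - ?X x0\<bar> < r \<Longrightarrow> g y \<in> J \<and> ?X (g y) = y \<and> 0 < ?X' x0 * ?X' (g y) \<and>
            (g has_real_derivative inverse (?X' (g y))) (at y)"
    then show thesis using that[of r g] X0 by simp
  qed
  have X'_pos: "0 < ?X' (g y)" if "\<bar>y\<bar> < r" for y
    using g[OF that] pos X0 by (simp add: zero_less_mult_iff)
  have chain: "((\<lambda>y. f (g y)) has_real_derivative f' / ?X' (g y)) (at y)"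
    if "\<bar>y\<bar> < r" "(f has_real_derivative f') (at (g y))" for f f' y
    using DERIV_chain2[where f = f and g = g and x = y, OF that(2), of "inverse (?X' (g y))"] g[OF that(1)] by (simp add: divide_inverse)
  have r0: "\<bar>0::real\<bar> < r" using r by simp
  interpret odd_comparison r "\<lambda>y. ?Z (g y)" "\<lambda>y. ?X' (g y) / (p (g y))\<^sup>2" "\<lambda>y. ?Z' (g y) / (p (g y))\<^sup>2"
    "\<lambda>y. \<kappa> (g y)" "\<lambda>y. \<mu> (g y)" "deriv \<kappa> x0 / p x0" "deriv \<mu> x0 / p x0"
  proof
    show "0 < r" by (rule r)
  next
    fix y assume y: "\<bar>y\<bar> < r"
    have J: "g y \<in> J" and X: "?X (g y) = y" using g[OF y] by auto
    have pg: "0 < p (g y)" using p_pos J by auto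
    show "((\<lambda>y. ?Z (g y)) has_real_derivative ?Z' (g y) / (p (g y))\<^sup>2 / (?X' (g y) / (p (g y))\<^sup>2)) (at y)"
      using chain[OF y D_cross[OF J, of x0]] pg by simp
    show "((\<lambda>y. ?X' (g y) / (p (g y))\<^sup>2) has_real_derivative - \<kappa> (g y) * y / (?X' (g y) / (p (g y))\<^sup>2)) (at y)"
      using chain[OF y moment_ode[OF J, of x0]] pg by (simp add: X mult_ac)
    show "((\<lambda>y. ?Z' (g y) / (p (g y))\<^sup>2) has_real_derivative - \<mu> (g y) * ?Z (g y) / (?X' (g y) / (p (g y))\<^sup>2)) (at y)"
      using chain[OF y cross_ode[OF J, of x0]] pg by (simp add: mult_ac)
    show "0 < ?X' (g y) / (p (g y))\<^sup>2" using X'_pos[OF y] pg by simp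
    have y': "\<bar>- y\<bar> < r" using y by simp
    have J': "g (- y) \<in> J" and X2: "?X (g (- y)) = - y" using g[OF y'] by auto
    have "m (g y) (g (- y)) = x0" using X X2 by (intro m_of_moments J J') simp
    then show "?Z (g (- y)) = - ?Z (g y)"
      using equation[OF J J'] by (simp add: cross_def algebra_simps)
    show "?Z (g y) \<noteq> 0" if "y \<noteq> 0"
    proof -
      have "g y \<noteq> x0" using X X0 that by auto
      then show ?thesis using cross_nz[OF J x0] by (simp add: cross_def mult.commute)
    qed
  next
    show "?Z' (g 0) / (p (g 0))\<^sup>2 \<noteq> 0"
      using wronskian_nz[OF x0] pos by (simp add: g0 cross_at)
    show "((\<lambda>y. \<kappa> (g y)) has_real_derivative deriv \<kappa> x0 / p x0) (at 0)"
      using chain[OF r0, of \<kappa>] \<kappa>\<mu>_deriv[OF x0] by (simp add: g0 X0)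
    show "((\<lambda>y. \<mu> (g y)) has_real_derivative deriv \<mu> x0 / p x0) (at 0)"
      using chain[OF r0, of \<mu>] \<kappa>\<mu>_deriv[OF x0] by (simp add: g0 X0)
  qed
  show "deriv \<mu> x0 = deriv \<kappa> x0" using derivatives_agree pos by simp
  show "deriv \<kappa> x0 = 0" if "\<And>x. x \<in> J \<Longrightarrow> \<mu> x - \<kappa> x = d" "d \<noteq> 0"
    using stationary[OF _ that(2)] that(1) g pos by simp
qed

lemma smooth_dichotomy:
  assumes "u0 \<in> J"
  shows "(\<exists>a b c d. a * d - b * c \<noteq> 0 \<and> agreement a b c d = J) \<or>
    (\<exists>\<alpha> \<beta>. \<forall>u\<in>J. \<kappa> u = \<alpha> \<and> \<mu> u = \<beta>)"
proof -
  have "((\<lambda>u. \<mu> u - \<kappa> u) has_real_derivative 0) (at u)" if u: "u \<in> J" for u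
    using DERIV_diff[OF \<kappa>\<mu>_deriv(2)[OF u] \<kappa>\<mu>_deriv(1)[OF u]] comparison_at(1)[OF u] by simp
  then obtain d where d: "\<And>u. u \<in> J \<Longrightarrow> \<mu> u - \<kappa> u = d"
    using constant_on_J[of "\<lambda>u. \<mu> u - \<kappa> u"] by blast
  show ?thesis
  proof (cases "d = 0")
    case True
    then have eq: "\<mu> u = \<kappa> u" if "u \<in> J" for u using d[OF that] by simp
    have "p u * deriv (deriv \<phi>) u = 2 * p1 u * deriv \<phi> u - \<kappa> u * (p u) ^ 5 * \<phi> u"
      "p u * deriv (deriv \<psi>) u = 2 * p1 u * deriv \<psi> u - \<kappa> u * (p u) ^ 5 * \<psi> u" if "u \<in> J" for u
      using \<phi>\<psi>_ode[OF that] eq[OF that] by simp_all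
    then obtain a b c d where ab: "\<forall>u\<in>J. \<phi> u = p u * (a * u + b)" and cd: "\<forall>u\<in>J. \<psi> u = p u * (c * u + d)"
      using affine_multiple[OF D\<phi> D2(2)] affine_multiple[OF D\<psi> D2(3)] by blast
    have agr: "agreement a b c d = J" using ab cd by (auto simp: agreement_def)
    obtain v where "v \<in> J" "v \<noteq> u0" using exists_other[OF assms] .
    then have "a * d - b * c \<noteq> 0" using agreement_det[of u0 a b c d v] agr assms by auto
    then show ?thesis using agr by blast
  next
    case False
    have "(\<kappa> has_real_derivative 0) (at u)" if u: "u \<in> J" for u
      using \<kappa>\<mu>_deriv(1)[OF u] comparison_at(2)[OF u d False] by simp
    then obtain \<alpha> where \<alpha>: "\<And>u. u \<in> J \<Longrightarrow> \<kappa> u = \<alpha>" using constant_on_J[of \<kappa>] by blast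
    have "\<mu> u = \<alpha> + d" if "u \<in> J" for u using d[OF that] \<alpha>[OF that] by simp
    with \<alpha> have "\<forall>u\<in>J. \<kappa> u = \<alpha> \<and> \<mu> u = \<alpha> + d" by simp
    then show ?thesis by (intro disjI2 exI)
  qed
qed

end

section \<open>The characterization of equality\<close>

theorem theorem7:
  fixes J :: "real set" and p q \<phi> \<psi> :: "real \<Rightarrow> real"
  assumes "J \<noteq> {}" and "open J" and "is_interval J"
    and "continuous_on J p" and "\<forall>u\<in>J. p u > 0"
    and "\<phi> C1_differentiable_on J" and "\<psi> C1_differentiable_on J"
    and "\<forall>u\<in>J. \<psi> u > 0"
    and "\<forall>u\<in>J. deriv (\<lambda>x. \<phi> x / \<psi> x) u \<noteq> 0"
    and q: "\<forall>u\<in>J. q u = u * p u"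
  shows "(\<forall>u\<in>J. \<forall>v\<in>J. bajraktarevic_mean J q p u v = bajraktarevic_mean J \<phi> \<psi> u v)
    \<longleftrightarrow>
      pair_equiv J (\<phi>, \<psi>) (q, p)
    \<or> (infinitely_differentiable_on \<phi> J \<and> infinitely_differentiable_on \<psi> J \<and>
       infinitely_differentiable_on p J \<and>
       (\<exists>\<alpha> \<beta> \<gamma> :: real. \<forall>u\<in>J.
          wronskian \<phi> \<psi> u = \<gamma> * (p u)\<^sup>2 \<and>
          wronskian (deriv q) (deriv p) u = \<alpha> * (wronskian q p u) ^ 3 \<and>
          wronskian (deriv \<phi>) (deriv \<psi>) u = \<beta> * (wronskian \<phi> \<psi> u) ^ 3))"
    (is "?means \<longleftrightarrow> ?equiv \<or> ?ode")
proof -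
  have C1: "(\<forall>u\<in>J. (f has_real_derivative deriv f u) (at u)) \<and> continuous_on J (deriv f)"
    if f: "f C1_differentiable_on J" for f :: "real \<Rightarrow> real"
  proof -
    obtain D where D: "\<forall>x\<in>J. (f has_vector_derivative D x) (at x)" "continuous_on J D"
      using f unfolding C1_differentiable_on_def by blast
    then have *: "(f has_real_derivative D x) (at x)" if "x \<in> J" for x
      using that by (simp add: has_real_derivative_iff_has_vector_derivative)
    then have eq: "deriv f x = D x" if "x \<in> J" for x using that DERIV_imp_deriv by blast
    then have "continuous_on J (deriv f)" using D(2) by (metis continuous_on_cong)
    then show ?thesis using * eq by auto
  qed
  have nz: "wronskian \<phi> \<psi> u \<noteq> 0" if u: "u \<in> J" for u
  proof -
    have "((\<lambda>x. \<phi> x / \<psi> x) has_real_derivative wronskian \<phi> \<psi> u / (\<psi> u * \<psi> u)) (at u)"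
      unfolding wronskian_def using C1 assms(6-8) u by (intro DERIV_divide) force+
    then have "deriv (\<lambda>x. \<phi> x / \<psi> x) u = wronskian \<phi> \<psi> u / (\<psi> u * \<psi> u)"
      by (rule DERIV_imp_deriv)
    then show ?thesis using assms(9) u by auto
  qed
  interpret mean_pair J p \<phi> \<psi>
    by unfold_locales (use assms C1 nz in auto)
  have q': "\<And>u. u \<in> J \<Longrightarrow> q u = u * p u" using q by blast
  have equiv_iff: "?equiv \<longleftrightarrow> (\<exists>a b c d. a * d - b * c \<noteq> 0 \<and> agreement a b c d = J)"
  proof -
    have "agreement a b c d = J \<longleftrightarrow> (\<forall>u\<in>J. \<phi> u = p u * (a * u + b) \<and> \<psi> u = p u * (c * u + d))" for a b c d
      unfolding agreement_def by blast
    then show ?thesis using pair_equiv_times_ident_iff[of J q p \<phi> \<psi>] q' by simp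
  qed
  have means_iff: "?means \<longleftrightarrow>
      (\<forall>u\<in>J. \<forall>v\<in>J. \<phi> (m u v) * (\<psi> u + \<psi> v) = \<psi> (m u v) * (\<phi> u + \<phi> v))"
    using means_eq_iff[OF _ _ q'] by simp
  show ?thesis
  proof
    assume ?means
    then interpret mean_equation J p \<phi> \<psi> by unfold_locales (use means_iff in blast)
    obtain \<gamma> where \<gamma>: "\<forall>u\<in>J. W u = \<gamma> * (p u)\<^sup>2" using wronskian_proportional by blast
    then interpret normalized_mean_equation J p \<phi> \<psi> \<gamma> by unfold_locales blast
    show "?equiv \<or> ?ode"
    proof (cases ?equiv)
      case False
      then have smooth: "\<forall>n. ndiff n p J \<and> ndiff n \<phi> J \<and> ndiff n \<psi> J"
        using agreement_or_smooth equiv_iff by blast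
      then interpret smooth_mean_equation J p \<phi> \<psi> \<gamma> by unfold_locales blast+
      obtain u0 where u0: "u0 \<in> J" using assms(1) by blast
      obtain \<alpha> \<beta> where "\<forall>u\<in>J. \<kappa> u = \<alpha> \<and> \<mu> u = \<beta>"
        using smooth_dichotomy[OF u0] False equiv_iff by blast
      then have "\<forall>u\<in>J. \<kappa> u = \<alpha> \<and> \<mu> u = (\<beta> / \<gamma>\<^sup>2) * \<gamma>\<^sup>2" using \<gamma>_nz[OF u0] by simp
      then have "\<forall>u\<in>J. wronskian (deriv q) (deriv p) u = \<alpha> * (wronskian q p u) ^ 3 \<and>
          wronskian (deriv \<phi>) (deriv \<psi>) u = (\<beta> / \<gamma>\<^sup>2) * (W u) ^ 3"
        using constant_coefficients_iff[OF q'] by blast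
      then have ?ode using smooth \<gamma> unfolding infinitely_differentiable_on_iff_ndiff by blast
      then show ?thesis ..
    qed simp
  next
    assume "?equiv \<or> ?ode"
    then show ?means
    proof
      assume ?equiv
      then show ?means using equiv_iff means_iff equation_of_agreement by blast
    next
      assume ?ode
      then obtain \<alpha> \<beta> \<gamma> where smooth: "\<And>n. ndiff n p J" "\<And>n. ndiff n \<phi> J" "\<And>n. ndiff n \<psi> J"
        and \<gamma>: "\<forall>u\<in>J. W u = \<gamma> * (p u)\<^sup>2"
        and ode: "\<forall>u\<in>J. wronskian (deriv q) (deriv p) u = \<alpha> * (wronskian q p u) ^ 3 \<and>
          wronskian (deriv \<phi>) (deriv \<psi>) u = \<beta> * (W u) ^ 3"
        unfolding infinitely_differentiable_on_iff_ndiff by blast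
      interpret smooth_pair J p \<phi> \<psi> \<gamma> by unfold_locales (use smooth \<gamma> in auto)
      have const: "\<kappa> u = \<alpha>" "\<mu> u = \<beta> * \<gamma>\<^sup>2" if "u \<in> J" for u
        using ode constant_coefficients_iff[OF q'] that by blast+
      have "\<phi> (m u v) * (\<psi> u + \<psi> v) = \<psi> (m u v) * (\<phi> u + \<phi> v)" if "u \<in> J" "v \<in> J" for u v
      proof (cases "u \<le> v")
        case True
        with that show ?thesis by (intro equation_of_constant_coefficients[OF const])
      next
        case False
        then have "\<phi> (m v u) * (\<psi> v + \<psi> u) = \<psi> (m v u) * (\<phi> v + \<phi> u)"
          using that by (intro equation_of_constant_coefficients[OF const]) auto
        then show ?thesis by (simp add: barycenter_commute add.commute)
      qed
      then show ?means using means_iff by blast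
    qed
  qed
qed

end
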